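(* For all $n\in\mathbb{N}$ (with $n\ge1$) and $\delta\in(0,1)$ there exists a pair $(\phi_n^\delta,\psi_n^\delta)\in(\mathcal{PC})$ such that $\phi_n^\delta\in(\mathcal{CM})$ and \[ \widehat{\psi_n^\delta}(t^{-1})\sim \bigl(\log^{[n]}(t)\bigr)^{\delta}\quad\text{as } t\to\infty, \] and \[ \widehat{\psi_n^\delta}(t^{-1})\sim t^{\delta}\,\bigl(\log(t^{-1})\bigr)^{\delta n}\quad\text{as } t\to0^+, \] where $\log^{[n]}=\underbrace{\log\circ\log\circ\dots\circ\log}_{n\text{ times}}$.
   Context: Notation: $\mathbb{R}_+=[0,\infty)$; $(f\ast g)(t)=\int_0^t f(t-s)g(s)\,ds$; $\widehat{f}(\lambda)=\int_0^\infty e^{-\lambda t}f(t)\,dt$ for $\lambda>0$ is the Laplace transform; $f(t)\sim g(t)$ as $t\to t_*$ means $\lim_{t\to t_*}f(t)/g(t)=1$. The iterated logarithm $\log^{[n]}(t)$ is considered for $t$ large enough that it is defined and positive. The superscript $\delta$ in $\phi_n^\delta,\psi_n^\delta$ is a label, not a power. $(k,\ell)\in(\mathcal{PC})$ means that $k\in L_{1,loc}(\mathbb{R}_+)$ is nonnegative and nonincreasing, $\ell\in L_{1,loc}(\mathbb{R}_+)$, and $(k\ast\ell)=1$ on $(0,\infty)$. $(\mathcal{CM})$ is the class of completely monotone functions: infinitely differentiable $f:(0,\infty)\to\mathbb{R}$ with $(-1)^nf^{(n)}(\lambda)\ge0$ for all integers $n\ge0$ and all $\lambda>0$. *)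

theory Defs
  imports "HOL-Analysis.Analysis" "HOL-Library.Landau_Symbols"
begin

text \<open>
  Functions on the half-line are represented by total functions of type \<open>real \<Rightarrow> real\<close>; no
  definition below depends on the values at negative arguments or, since kernels may be singular
  there, on the value at \<open>0\<close>.
\<close>

definition locally_integrable_half_line :: "(real \<Rightarrow> real) \<Rightarrow> bool" where
  "locally_integrable_half_line f \<longleftrightarrow> (\<forall>T\<ge>0. f absolutely_integrable_on {0..T})"

definition half_line_convolution :: "(real \<Rightarrow> real) \<Rightarrow> (real \<Rightarrow> real) \<Rightarrow> real \<Rightarrow> real" where
  "half_line_convolution f g t = (LINT s:{0..t}|lebesgue. f (t - s) * g s)"

text \<open>
  The Bochner integral of a non-integrable function is \<open>0\<close>, so an equation that gives an integral
  a nonzero value includes its absolute convergence. This applies to the convolution identity in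
  \<open>PC\<close>. Likewise, if the Laplace transform is nonzero at arbitrarily small positive arguments, then
  the integral converges absolutely at every positive argument.
\<close>

definition laplace_transform :: "(real \<Rightarrow> real) \<Rightarrow> real \<Rightarrow> real" where
  "laplace_transform f z = (LINT t:{0..}|lebesgue. exp (- z * t) * f t)"

definition PC :: "((real \<Rightarrow> real) \<times> (real \<Rightarrow> real)) set" where
  "PC = {(k, l).
     locally_integrable_half_line k \<and> (\<forall>t>0. 0 \<le> k t) \<and> antimono_on {0<..} k \<and>
     locally_integrable_half_line l \<and>
     (\<forall>t>0. half_line_convolution k l t = 1)}"

definition CM :: "(real \<Rightarrow> real) set" where
  "CM = {f. \<forall>n. \<forall>x>0. (deriv ^^ n) f field_differentiable at x \<and>
                      0 \<le> (- 1) ^ n * (deriv ^^ n) f x}"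

end

theory Submission
  imports Defs "HOL-Complex_Analysis.Complex_Analysis" "HOL-Probability.Probability"
    "HOL-Real_Asymp.Real_Asymp"
begin

text \<open>
  Let \<open>G z = (z - 1) / ln z\<close>. It is the mean of \<open>z powr a\<close> over \<open>0 \<le> a \<le> 1\<close>, so it maps the closed upper
  half plane without \<open>0\<close> (negative reals being approached from above) to the slit plane, with
  arguments in \<open>[0, \<pi>)\<close>; the same holds for its iterates \<open>g\<close>. With \<open>g = G ^^ n\<close>, the functions
  \<open>g powr \<delta> / z\<close> and \<open>g powr - \<delta>\<close> therefore have imaginary parts of one sign on the cut,
  and Cauchy's formula on the slit plane turns them into Stieltjes transforms of nonnegative densities,
  that is, into Laplace transforms of completely monotone \<open>\<phi>\<close> and \<open>\<psi>\<close>. As the product of the two transforms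
  is \<open>1 / z\<close>, the convolution of \<open>\<phi>\<close> and \<open>\<psi>\<close> is \<open>1\<close> by uniqueness of Laplace transforms. Finally
  \<open>1 / G (1 / b) = b ln b / (b - 1)\<close> behaves like \<open>ln b\<close> at infinity and like \<open>b ln (1 / b)\<close> at \<open>0\<close>, and
  iterating this gives the two asymptotic equivalences.
\<close>

section \<open>The exponential mean on a strip\<close>

text \<open>An iterated logarithm cannot be used directly: it has a zero and is undefined for small
  arguments. The numerator of \<open>G\<close> cancels the zero of \<open>ln z\<close> at
  \<open>1\<close> and leaves a zero-free function on the whole slit plane, so
  \<open>1 / G (1 / b)\<close> is a positive substitute for \<open>ln b\<close> at every
  \<open>b > 0\<close>. Cauchy's formula requires that the function vanish at infinity and that its
  product with \<open>z\<close> vanish at \<open>0\<close>. For \<open>g powr \<delta> / z\<close>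
  and \<open>g powr - \<delta>\<close> this rests on four facts: \<open>g\<close> tends to infinity
  and \<open>|g| \<le> |z|\<close> near infinity; \<open>g\<close> tends to \<open>0\<close> and
  \<open>|g| \<ge> |z|\<close> near \<open>0\<close>. The comparisons with \<open>z\<close> leave a
  power with exponent \<open>1 - \<delta>\<close> in absolute value, which is where strictness of
  \<open>\<delta> < 1\<close> enters. The densities on the cut are never estimated, since their sign
  and monotone convergence suffice. The convolution must equal \<open>1\<close> at every
  \<open>t > 0\<close>, whereas uniqueness of transforms alone gives almost every \<open>t\<close>;
  continuity of the convolution closes this gap.\<close>

text \<open>
  The coordinate is \<open>u = ln z\<close>: the slit plane together with both sides of its cut becomes a closed
  strip, so that no boundary values are needed, and \<open>G\<close> becomes \<open>log_mean\<close>. The integral form of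
  \<open>exp_mean u = (exp u - 1) / u\<close> takes care of the removable singularity.
\<close>

definition strip :: "complex set" where
  "strip = {u. \<bar>Im u\<bar> \<le> pi}"

text \<open>In \<open>z = exp u\<close> this is the limit of \<open>z\<close> to infinity, uniform
  in the argument and including both sides of the cut; \<open>strip_bot\<close> is the limit to
  \<open>0\<close>. The vertical edges of the contour need this uniformity.\<close>

definition strip_top :: "complex filter" where
  "strip_top = inf (filtercomap Re at_top) (principal strip)"

definition strip_bot :: "complex filter" where
  "strip_bot = inf (filtercomap Re at_bot) (principal strip)"

definition exp_mean :: "complex \<Rightarrow> complex" where
  "exp_mean u = integral {0..1} (\<lambda>a. exp (of_real a * u))"

definition log_mean :: "complex \<Rightarrow> complex" where
  "log_mean u = Ln (exp_mean u)"

lemma convex_strip: "convex strip"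
proof -
  have "strip = {u. Im u \<ge> -pi} \<inter> {u. Im u \<le> pi}"
    by (auto simp: strip_def)
  then show ?thesis
    using convex_Int[OF convex_halfspace_Im_ge convex_halfspace_Im_le, of "- pi" pi] by simp
qed

lemma filterlim_Re_strip_top: "filterlim Re at_top strip_top"
  unfolding strip_top_def by (rule filterlim_mono[OF filterlim_filtercomap]) auto

lemma filterlim_Re_strip_bot: "filterlim Re at_bot strip_bot"
  unfolding strip_bot_def by (rule filterlim_mono[OF filterlim_filtercomap]) auto

lemma eventually_strip_top: "eventually (\<lambda>u. u \<in> strip) strip_top"
  by (auto simp: strip_top_def eventually_inf_principal)

lemma eventually_strip_bot: "eventually (\<lambda>u. u \<in> strip) strip_bot"
  by (auto simp: strip_bot_def eventually_inf_principal)

section \<open>Range of the exponential mean and of its logarithm\<close>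

lemma exp_mean_integrable: "(\<lambda>a. exp (of_real a * u)) integrable_on {0..1}" for u :: complex
  by (intro integrable_continuous_real continuous_intros)

lemma exp_mean_mult: "u * exp_mean u = exp u - 1"
proof -
  have "((\<lambda>a. u * exp (of_real a * u)) has_integral exp (of_real 1 * u) - exp (of_real 0 * u)) {0..1}"
    by (rule fundamental_theorem_of_calculus)
       (auto intro!: derivative_eq_intros has_vector_derivative_real_field)
  then show ?thesis
    unfolding exp_mean_def by (subst integral_mult_right [symmetric]) (auto dest: integral_unique)
qed

lemma exp_mean_0 [simp]: "exp_mean 0 = 1"
  by (simp add: exp_mean_def)

lemma exp_mean_holomorphic: "exp_mean holomorphic_on UNIV"
proof -
  have "(\<lambda>u. integral (cbox 0 1) (\<lambda>a::real. exp (of_real a * u))) holomorphic_on UNIV"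
    by (rule leibniz_rule_holomorphic[where fx = "\<lambda>u a. of_real a * exp (of_real a * u)"])
       (auto simp: case_prod_unfold intro!: derivative_eq_intros exp_mean_integrable continuous_intros)
  then show ?thesis
    by (simp add: exp_mean_def [abs_def])
qed

lemma exp_mean_cnj: "exp_mean (cnj u) = cnj (exp_mean u)"
  unfolding exp_mean_def by (simp add: integral_cnj exp_cnj)

lemma Im_exp_mean: "Im (exp_mean u) = integral {0..1} (\<lambda>a. exp (a * Re u) * sin (a * Im u))"
  unfolding exp_mean_def
  using integral_linear[OF exp_mean_integrable bounded_linear_Im, of u]
  by (simp add: o_def Im_exp)

lemma Re_exp_mean: "Re (exp_mean u) = integral {0..1} (\<lambda>a. exp (a * Re u) * cos (a * Im u))"
  unfolding exp_mean_def
  using integral_linear[OF exp_mean_integrable bounded_linear_Re, of u]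
  by (simp add: o_def Re_exp)

lemma integral_pos_continuous:
  fixes f :: "real \<Rightarrow> real"
  assumes cont: "continuous_on {a..b} f" and "a < b"
    and nonneg: "\<And>x. x \<in> {a..b} \<Longrightarrow> 0 \<le> f x" and "c \<in> {a..b}" "f c \<noteq> 0"
  shows "0 < integral {a..b} f"
proof -
  have "integral {a..b} f \<noteq> 0"
    using integral_eq_0_iff[OF cont \<open>a < b\<close> nonneg] assms(4,5) by blast
  moreover have "0 \<le> integral {a..b} f"
    by (rule integral_nonneg[OF integrable_continuous_real[OF cont] nonneg])
  ultimately show ?thesis by simp
qed

lemma Im_exp_mean_pos:
  assumes "0 < Im u" "Im u \<le> pi"
  shows "0 < Im (exp_mean u)"
  unfolding Im_exp_mean
proof (rule integral_pos_continuous)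
  show "0 \<le> exp (a * Re u) * sin (a * Im u)" if "a \<in> {0..1}" for a
    using assms that mult_mono[of a 1 "Im u" pi] by (auto intro!: mult_nonneg_nonneg sin_ge_zero)
  \<comment> \<open>The midpoint is taken because the sine vanishes at \<open>a = 0\<close>, and at
    \<open>a = 1\<close> when \<open>Im u = pi\<close>; positivity thus holds on the edge of the
    strip as well.\<close>
  have "0 < sin (1/2 * Im u)"
    using assms by (intro sin_gt_zero) auto
  then show "exp (1/2 * Re u) * sin (1/2 * Im u) \<noteq> 0" by simp
qed (auto intro!: continuous_intros)

lemma Re_exp_mean_pos:
  assumes "Im u = 0"
  shows "0 < Re (exp_mean u)"
  unfolding Re_exp_mean
  by (rule integral_pos_continuous[where c = 0]) (use assms in \<open>auto intro!: continuous_intros\<close>)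

lemma Im_exp_mean_neg:
  assumes "Im u < 0" "- pi \<le> Im u"
  shows "Im (exp_mean u) < 0"
  using Im_exp_mean_pos[of "cnj u"] assms by (simp add: exp_mean_cnj)

text \<open>Off the real axis the mean has nonzero imaginary part, and on it the mean is positive.
  Hence the principal logarithm of the mean is analytic on the closed strip, edges included.\<close>

lemma exp_mean_notin_nonpos_Reals:
  assumes "u \<in> strip"
  shows "exp_mean u \<notin> \<real>\<^sub>\<le>\<^sub>0"
proof -
  consider "Im u = 0" | "0 < Im u" "Im u \<le> pi" | "Im u < 0" "- pi \<le> Im u"
    using assms unfolding strip_def by fastforce
  then show ?thesis
    by cases (auto simp: complex_nonpos_Reals_iff dest: Im_exp_mean_pos Im_exp_mean_neg Re_exp_mean_pos)
qed

lemma exp_mean_nonzero: "u \<in> strip \<Longrightarrow> exp_mean u \<noteq> 0"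
  using exp_mean_notin_nonpos_Reals by force

lemma log_mean_in_strip: "u \<in> strip \<Longrightarrow> log_mean u \<in> strip"
  using Im_Ln_le_pi[of "exp_mean u"] mpi_less_Im_Ln[of "exp_mean u"] exp_mean_nonzero[of u]
  by (simp add: log_mean_def strip_def abs_le_iff)

lemma log_mean_cnj: "u \<in> strip \<Longrightarrow> log_mean (cnj u) = cnj (log_mean u)"
  using exp_mean_notin_nonpos_Reals by (simp add: log_mean_def exp_mean_cnj cnj_Ln)

lemma Im_log_mean_nonneg:
  assumes "u \<in> strip" "0 \<le> Im u"
  shows "0 \<le> Im (log_mean u)"
proof (cases "Im u = 0")
  case True
  then have "cnj u = u" by (simp add: complex_eq_iff)
  then have "cnj (log_mean u) = log_mean u"
    using log_mean_cnj[OF assms(1)] by simp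
  then show ?thesis by (metis cnj.simps(2) neg_equal_zero order_refl)
next
  case False
  then have "0 < Im (exp_mean u)"
    using assms by (intro Im_exp_mean_pos) (auto simp: strip_def)
  then show ?thesis
    using assms(1) by (simp add: log_mean_def Im_Ln_pos_lt_imp less_imp_le exp_mean_nonzero)
qed

lemma log_mean_analytic: "log_mean analytic_on strip"
proof -
  have "(Ln \<circ> exp_mean) analytic_on strip"
  proof (rule analytic_on_compose_gen)
    show "exp_mean analytic_on strip"
      using exp_mean_holomorphic analytic_on_holomorphic[of exp_mean strip] by auto
    show "Ln analytic_on (- \<real>\<^sub>\<le>\<^sub>0)"
      by (auto intro: analytic_intros)
  qed (use exp_mean_notin_nonpos_Reals in auto)
  then show ?thesis by (simp add: log_mean_def [abs_def] o_def)
qed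

section \<open>Size of the logarithmic mean at both ends of the strip\<close>

lemma Re_log_mean: "u \<in> strip \<Longrightarrow> Re (log_mean u) = ln (norm (exp_mean u))"
  by (simp add: log_mean_def exp_mean_nonzero)

lemma norm_exp_mean: "u \<noteq> 0 \<Longrightarrow> norm (exp_mean u) = norm (exp u - 1) / norm u"
  using arg_cong[OF exp_mean_mult, of norm u] by (simp add: norm_mult field_simps)

lemma norm_le_strip: "u \<in> strip \<Longrightarrow> norm u \<le> \<bar>Re u\<bar> + pi"
  using cmod_le[of u] by (auto simp: strip_def)

text \<open>Each \<open>exp (a * u)\<close> in the mean has modulus at most
  \<open>exp (Re u)\<close>; thus \<open>|G z| \<le> |z|\<close> for
  \<open>|z| \<ge> 1\<close>.\<close>

lemma Re_log_mean_le:
  assumes "u \<in> strip" "0 \<le> Re u"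
  shows "Re (log_mean u) \<le> Re u"
proof -
  have "norm (exp_mean u) \<le> integral {0..1} (\<lambda>a::real. exp (Re u))"
    unfolding exp_mean_def using assms(2)
    by (intro integral_norm_bound_integral exp_mean_integrable integrable_const_ivl)
       (auto intro: mult_left_le_one_le)
  then have "ln (norm (exp_mean u)) \<le> ln (exp (Re u))"
    using exp_mean_nonzero[OF assms(1)] by (subst ln_le_cancel_iff) auto
  then show ?thesis
    using assms(1) by (simp add: Re_log_mean)
qed

text \<open>This serves both ends: the bound tends to infinity with \<open>Re u\<close>, and as
  \<open>Re u\<close> tends to minus infinity it decreases only logarithmically, so it eventually
  exceeds \<open>Re u\<close>.\<close>

lemma Re_log_mean_ge:
  assumes "u \<in> strip" "Re u \<noteq> 0"
  shows "ln (\<bar>exp (Re u) - 1\<bar> / (\<bar>Re u\<bar> + pi)) \<le> Re (log_mean u)"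
proof -
  have "u \<noteq> 0" using assms(2) by auto
  have "\<bar>exp (Re u) - 1\<bar> / (\<bar>Re u\<bar> + pi) \<le> norm (exp u - 1) / norm u"
    using norm_triangle_ineq3[of "exp u" 1] norm_le_strip[OF assms(1)] \<open>u \<noteq> 0\<close>
    by (intro frac_le) auto
  then show ?thesis
    using assms \<open>u \<noteq> 0\<close> pi_gt_zero
    by (auto simp: Re_log_mean norm_exp_mean[symmetric] intro!: ln_mono divide_pos_pos add_nonneg_pos)
qed

text \<open>The numerator \<open>exp u - 1\<close> stays bounded while \<open>u\<close> grows, so
  \<open>G z\<close> tends to \<open>0\<close> with \<open>z\<close>, though only like
  \<open>1 / ln (1 / |z|)\<close>.\<close>

lemma Re_log_mean_bot_le:
  assumes "u \<in> strip" "Re u < 0"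
  shows "Re (log_mean u) \<le> ln (2 / (- Re u))"
proof -
  have "u \<noteq> 0" using assms(2) by auto
  have "norm (exp u - 1) \<le> exp (Re u) + 1"
    using norm_triangle_ineq4[of "exp u" 1] by simp
  also have "\<dots> \<le> 2" using assms(2) by simp
  finally have "norm (exp u - 1) / norm u \<le> 2 / (- Re u)"
    using abs_Re_le_cmod[of u] assms(2) by (intro frac_le) auto
  then show ?thesis
    using assms \<open>u \<noteq> 0\<close> exp_mean_nonzero[OF assms(1)]
    by (auto simp: Re_log_mean norm_exp_mean[symmetric])
qed

lemma filterlim_log_mean_top: "filterlim log_mean strip_top strip_top"
proof -
  have "filterlim (\<lambda>x::real. ln (\<bar>exp x - 1\<bar> / (\<bar>x\<bar> + pi))) at_top at_top"
    by real_asymp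
  then have "filterlim (\<lambda>u. ln (\<bar>exp (Re u) - 1\<bar> / (\<bar>Re u\<bar> + pi))) at_top strip_top"
    by (rule filterlim_compose[OF _ filterlim_Re_strip_top])
  moreover have "eventually (\<lambda>u. 0 < Re u) strip_top"
    using filterlim_Re_strip_top eventually_gt_at_top[of 0] by (auto simp: filterlim_iff)
  then have "eventually (\<lambda>u. ln (\<bar>exp (Re u) - 1\<bar> / (\<bar>Re u\<bar> + pi)) \<le> Re (log_mean u)) strip_top"
    using eventually_strip_top by eventually_elim (rule Re_log_mean_ge, auto)
  ultimately have "filterlim (\<lambda>u. Re (log_mean u)) at_top strip_top"
    by (rule filterlim_at_top_mono)
  then have "filterlim log_mean (filtercomap Re at_top) strip_top"
    by (simp add: filterlim_filtercomap_iff o_def)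
  moreover have "filterlim log_mean (principal strip) strip_top"
    unfolding filterlim_principal using eventually_strip_top
    by eventually_elim (rule log_mean_in_strip)
  ultimately have "filterlim log_mean (inf (filtercomap Re at_top) (principal strip)) strip_top"
    by (simp only: filterlim_inf)
  then show ?thesis
    by (simp only: strip_top_def [symmetric])
qed

lemma filterlim_log_mean_bot: "filterlim log_mean strip_bot strip_bot"
proof -
  have "filterlim (\<lambda>x::real. ln (2 / (- x))) at_bot at_bot"
    by real_asymp
  then have "filterlim (\<lambda>u. ln (2 / (- Re u))) at_bot strip_bot"
    by (rule filterlim_compose[OF _ filterlim_Re_strip_bot])
  moreover have "eventually (\<lambda>u. Re u < 0) strip_bot"
    using filterlim_Re_strip_bot eventually_gt_at_bot[of "0::real"] unfolding filterlim_iff by blast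
  then have "eventually (\<lambda>u. Re (log_mean u) \<le> ln (2 / (- Re u))) strip_bot"
    using eventually_strip_bot by eventually_elim (rule Re_log_mean_bot_le)
  ultimately have "filterlim (\<lambda>u. Re (log_mean u)) at_bot strip_bot"
    by (rule filterlim_at_bot_mono)
  then have "filterlim log_mean (filtercomap Re at_bot) strip_bot"
    by (simp add: filterlim_filtercomap_iff o_def)
  moreover have "filterlim log_mean (principal strip) strip_bot"
    unfolding filterlim_principal using eventually_strip_bot
    by eventually_elim (rule log_mean_in_strip)
  ultimately have "filterlim log_mean (inf (filtercomap Re at_bot) (principal strip)) strip_bot"
    by (simp only: filterlim_inf)
  then show ?thesis
    by (simp only: strip_bot_def [symmetric])
qed

lemma eventually_Re_log_mean_ge: "eventually (\<lambda>u. Re u \<le> Re (log_mean u)) strip_bot"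
proof -
  have "eventually (\<lambda>x::real. x \<le> ln (\<bar>exp x - 1\<bar> / (\<bar>x\<bar> + pi))) at_bot"
    by real_asymp
  then have "eventually (\<lambda>x::real. x < 0 \<and> x \<le> ln (\<bar>exp x - 1\<bar> / (\<bar>x\<bar> + pi))) at_bot"
    using eventually_gt_at_bot[of 0] by (rule eventually_conj[rotated])
  then have "eventually (\<lambda>u. Re u < 0 \<and> Re u \<le> ln (\<bar>exp (Re u) - 1\<bar> / (\<bar>Re u\<bar> + pi))) strip_bot"
    using filterlim_Re_strip_bot unfolding filterlim_iff by blast
  then show ?thesis
    using eventually_strip_bot by eventually_elim (rule order_trans[OF conjunct2 Re_log_mean_ge], auto)
qed

section \<open>Iterates of the logarithmic mean\<close>

lemma log_mean_iter_in_strip: "u \<in> strip \<Longrightarrow> (log_mean ^^ n) u \<in> strip"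
  by (induction n) (auto intro: log_mean_in_strip)

lemma log_mean_iter_cnj: "u \<in> strip \<Longrightarrow> (log_mean ^^ n) (cnj u) = cnj ((log_mean ^^ n) u)"
  by (induction n) (auto simp: log_mean_cnj log_mean_iter_in_strip)

lemma Im_log_mean_iter_nonneg: "u \<in> strip \<Longrightarrow> 0 \<le> Im u \<Longrightarrow> 0 \<le> Im ((log_mean ^^ n) u)"
  by (induction n) (auto intro: Im_log_mean_nonneg log_mean_iter_in_strip)

lemma log_mean_iter_analytic: "(log_mean ^^ n) analytic_on strip"
proof (induction n)
  case (Suc n)
  show ?case
    unfolding funpow.simps
    by (rule analytic_on_compose_gen[OF Suc log_mean_analytic]) (rule log_mean_iter_in_strip)
qed (simp add: id_def)

lemma filterlim_log_mean_iter_top: "filterlim (log_mean ^^ n) strip_top strip_top"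
proof (induction n)
  case (Suc n)
  show ?case
    unfolding funpow.simps o_def by (rule filterlim_compose[OF filterlim_log_mean_top Suc])
qed (simp add: id_def filterlim_ident)

lemma filterlim_log_mean_iter_bot: "filterlim (log_mean ^^ n) strip_bot strip_bot"
proof (induction n)
  case (Suc n)
  show ?case
    unfolding funpow.simps o_def by (rule filterlim_compose[OF filterlim_log_mean_bot Suc])
qed (simp add: id_def filterlim_ident)

text \<open>The one-step inequality holds where the real part is nonnegative; the divergence of the
  iterates makes it available at \<open>(log_mean ^^ n) u\<close>, and the inequalities
  chain.\<close>

lemma eventually_Re_log_mean_iter_le:
  "eventually (\<lambda>u. Re ((log_mean ^^ n) u) \<le> Re u) strip_top"
proof (induction n)
  case (Suc n)
  have "eventually (\<lambda>u. 0 \<le> Re u) strip_top"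
    using filterlim_Re_strip_top eventually_ge_at_top[of 0] by (auto simp: filterlim_iff)
  then have "eventually (\<lambda>u. Re (log_mean u) \<le> Re u) strip_top"
    using eventually_strip_top by eventually_elim (auto intro: Re_log_mean_le)
  then have "eventually (\<lambda>u. Re (log_mean ((log_mean ^^ n) u)) \<le> Re ((log_mean ^^ n) u)) strip_top"
    using filterlim_log_mean_iter_top[of n] by (auto simp: filterlim_iff)
  with Suc show ?case
    by eventually_elim auto
qed auto

lemma eventually_Re_log_mean_iter_ge:
  "eventually (\<lambda>u. Re u \<le> Re ((log_mean ^^ n) u)) strip_bot"
proof (induction n)
  case (Suc n)
  have "eventually (\<lambda>u. Re ((log_mean ^^ n) u) \<le> Re (log_mean ((log_mean ^^ n) u))) strip_bot"
    using eventually_Re_log_mean_ge filterlim_log_mean_iter_bot[of n] by (auto simp: filterlim_iff)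
  with Suc show ?case
    by eventually_elim auto
qed auto

section \<open>Cauchy's formula and Stieltjes representation\<close>

lemma contour_integral_linepath_horizontal:
  assumes "a < b"
  shows "contour_integral (linepath (Complex a c) (Complex b c)) f = integral {a..b} (\<lambda>x. f (Complex x c))"
proof -
  have eq: "linepath (Complex a c) (Complex b c) x = Complex ((b - a) * x + a) c" for x
    by (simp add: linepath_def complex_eq_iff algebra_simps)
  have "contour_integral (linepath (Complex a c) (Complex b c)) f =
      of_real (b - a) * integral {0..1} (\<lambda>x. f (Complex ((b - a) * x + a) c))"
    unfolding contour_integral_integral vector_derivative_linepath_at eq
    by (subst integral_mult_left) (simp add: Complex_eq)
  also have "integral {0..1} (\<lambda>x. f (Complex ((b - a) * x + a) c)) =
      integral ((\<lambda>x. x / (b - a)) ` {0..b - a}) (\<lambda>x. f (Complex ((b - a) * x + a) c))"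
    using assms by simp
  also have "\<dots> = integral {a - a..b - a} (\<lambda>x. f (Complex (x + a) c)) / of_real (b - a)"
    using assms by (subst integral_stretch_real) (auto simp: scaleR_conv_of_real)
  also have "integral {a - a..b - a} (\<lambda>x. f (Complex (x + a) c)) = integral {a..b} (\<lambda>x. f (Complex x c))"
    by (subst integral_shift_real_ivl) (rule refl)
  finally show ?thesis
    using assms by simp
qed

text \<open>\<open>F\<close> is a filter on points and \<open>G\<close> one on the parameter;
  \<open>seg\<close> says that the segments eventually enter every set of \<open>F\<close>. Bounded
  length then suffices for the standard estimate.\<close>

lemma contour_integral_linepath_tendsto_0:
  fixes q :: "complex \<Rightarrow> complex" and a b :: "'a \<Rightarrow> complex"
  assumes lim: "(q \<longlongrightarrow> 0) F"
    and seg: "\<And>P. eventually P F \<Longrightarrow> eventually (\<lambda>R. \<forall>w\<in>closed_segment (a R) (b R). P w) G"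
    and cont: "eventually (\<lambda>R. continuous_on (closed_segment (a R) (b R)) q) G"
    and len: "\<And>R. norm (b R - a R) \<le> L"
  shows "((\<lambda>R. contour_integral (linepath (a R) (b R)) q) \<longlongrightarrow> 0) G"
proof (rule tendstoI)
  fix e :: real assume "0 < e"
  \<comment> \<open>The summand \<open>1\<close> keeps the divisor positive when
    \<open>L = 0\<close>; the factor \<open>2\<close> makes the final estimate strict.\<close>
  define d where "d = e / (2 * (\<bar>L\<bar> + 1))"
  have "0 < d" using \<open>0 < e\<close> by (auto simp: d_def intro!: divide_pos_pos)
  have "eventually (\<lambda>w. norm (q w) < d) F"
    using tendstoD[OF lim \<open>0 < d\<close>] by simp
  from seg[OF this] cont
  show "eventually (\<lambda>R. dist (contour_integral (linepath (a R) (b R)) q) 0 < e) G"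
  proof eventually_elim
    case (elim R)
    have "norm (contour_integral (linepath (a R) (b R)) q) \<le> d * norm (b R - a R)"
      using elim \<open>0 < d\<close>
      by (intro contour_integral_bound_linepath contour_integrable_continuous_linepath) (auto intro: less_imp_le)
    also have "\<dots> \<le> d * (\<bar>L\<bar> + 1)"
      using len[of R] \<open>0 < d\<close> by (intro mult_left_mono) auto
    also have "\<dots> < e"
      using \<open>0 < e\<close> by (simp add: d_def field_simps add_pos_nonneg)
    finally show ?case by simp
  qed
qed

text \<open>The factor after \<open>h w\<close> is the pullback of the Cauchy kernel
  \<open>1 / (s - x)\<close> under \<open>s = exp w\<close>, with \<open>x = exp z\<close>. The
  other solutions of \<open>exp w = exp z\<close> differ from \<open>z\<close> by nonzero multiples
  of \<open>2 * pi * \<i>\<close> and lie outside the strip.\<close>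

lemma strip_Cauchy_integral:
  assumes ana: "h analytic_on strip" and "\<bar>z\<bar> < R"
  shows "((\<lambda>w. h w * (exp w / (exp w - exp (complex_of_real z)))) has_contour_integral 2 * pi * \<i> * h z)
           (rectpath (Complex (- R) (- pi)) (Complex R pi))"
proof -
  \<comment> \<open>since \<open>exp w / (exp w - exp z) = exp (w - z) / ((w - z) * exp_mean (w - z))\<close>, the only pole is simple\<close>
  define f where "f w = h w * exp (w - z) / exp_mean (w - z)" for w
  have shift: "w - of_real z \<in> strip" if "w \<in> strip" for w
    using that by (simp add: strip_def)
  have "f holomorphic_on strip"
    unfolding f_def
    by (intro holomorphic_intros analytic_imp_holomorphic[OF ana] exp_mean_nonzero shift
          holomorphic_on_compose[unfolded o_def, where g = exp_mean, OF _ holomorphic_on_subset[OF exp_mean_holomorphic]]) auto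
  moreover have sub: "path_image (rectpath (Complex (- R) (- pi)) (Complex R pi)) \<subseteq> strip - {of_real z}"
    using assms(2) pi_gt_zero by (auto simp: path_image_rectpath strip_def)
  moreover have box: "of_real z \<in> box (Complex (- R) (- pi)) (Complex R pi)"
    using assms(2) pi_gt_zero by (auto simp: in_box_complex_iff)
  have "of_real z \<in> interior strip"
    by (rule interiorI[OF open_box box]) (auto simp: in_box_complex_iff strip_def)
  ultimately have "((\<lambda>w. f w / (w - z)) has_contour_integral 2 * pi * \<i> *
      winding_number (rectpath (Complex (- R) (- pi)) (Complex R pi)) z * f z)
      (rectpath (Complex (- R) (- pi)) (Complex R pi))"
    by (intro Cauchy_integral_formula_convex_simple) (auto intro: convex_strip)
  then have "((\<lambda>w. f w / (w - z)) has_contour_integral 2 * pi * \<i> * h z)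
      (rectpath (Complex (- R) (- pi)) (Complex R pi))"
    by (simp add: winding_number_rectpath[OF box] f_def)
  then show ?thesis
  proof (rule has_contour_integral_eq)
    fix w assume "w \<in> path_image (rectpath (Complex (- R) (- pi)) (Complex R pi))"
    then have w: "w \<noteq> of_real z" "w - z \<in> strip" using sub shift by auto
    have "exp (w - z) - 1 \<noteq> 0"
      using exp_mean_mult[of "w - z"] exp_mean_nonzero[OF w(2)] w(1) by (metis eq_iff_diff_eq_0 mult_eq_0_iff)
    moreover have "f w / (w - z) = h w * exp (w - z) / (exp (w - z) - 1)"
      unfolding exp_mean_mult[symmetric] by (simp add: f_def mult_ac)
    moreover have "exp w = exp (w - z) * exp (of_real z)" by (simp add: exp_diff)
    then have "exp w / (exp w - exp (complex_of_real z)) =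
        (exp (w - z) * exp (of_real z)) / ((exp (w - z) - 1) * exp (of_real z))"
      by (simp add: algebra_simps)
    ultimately show "f w / (w - z) = h w * (exp w / (exp w - exp (complex_of_real z)))"
      by simp
  qed
qed

text \<open>The horizontal edges are the two sides of the cut. There \<open>exp w = - exp y\<close>,
  so the Cauchy factor is real and the same on both, while \<open>h\<close> takes conjugate values;
  their difference leaves \<open>Im h\<close>. With \<open>s = exp y\<close> the integral has the
  Stieltjes kernel \<open>1 / (s + x)\<close> at \<open>x = exp z\<close>.\<close>

lemma stieltjes_limit:
  assumes ana: "h analytic_on strip"
    and sym: "\<And>u. u \<in> strip \<Longrightarrow> h (cnj u) = cnj (h u)"
    and top: "(h \<longlongrightarrow> 0) strip_top"
    and bot: "((\<lambda>u. h u * exp u) \<longlongrightarrow> 0) strip_bot"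
  shows "((\<lambda>R. integral {-R..R} (\<lambda>y. - Im (h (Complex y pi)) / pi * (exp y / (exp y + exp z))))
           \<longlongrightarrow> Re (h (of_real z))) at_top"
proof -
  define q where "q w = h w * (exp w / (exp w - exp (complex_of_real z)))" for w
  define S where "S R = linepath (Complex R (- pi)) (Complex R pi)" for R
  let ?A = "\<lambda>R. integral {-R..R} (\<lambda>y. - Im (h (Complex y pi)) / pi * (exp y / (exp y + exp z)))"
  have conth: "continuous_on strip h"
    using ana by (intro holomorphic_on_imp_continuous_on analytic_imp_holomorphic)
  have cont: "continuous_on T q" if "T \<subseteq> strip" "\<And>w. w \<in> T \<Longrightarrow> exp w \<noteq> exp (complex_of_real z)" for T
    unfolding q_def using that by (auto intro!: continuous_intros continuous_on_subset[OF conth])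
  have hor: "exp (Complex y c) = - of_real (exp y)" if "c = pi \<or> c = - pi" for y c
    using that by (auto simp: complex_eq_iff Re_exp Im_exp)
  have vert: "exp w \<noteq> exp (complex_of_real z)" if "\<bar>Re w\<bar> > \<bar>z\<bar>" for w
    using that by (metis Re_complex_of_real exp_inj_iff norm_exp_eq_Re less_irrefl)
  have nz: "exp y + exp z \<noteq> 0" for y :: real
    using exp_gt_zero[of y] exp_gt_zero[of z] by linarith
  have nz': "- of_real (exp y) - exp (complex_of_real z) \<noteq> 0" for y :: real
  proof -
    have "- of_real (exp y) - exp (complex_of_real z) = of_real (- (exp y + exp z))" 
      by (simp add: exp_of_real)
    then show ?thesis using nz[of y] by (metis neg_equal_0_iff_equal of_real_eq_0_iff)
  qed
  have qhor: "q (Complex y c) = h (Complex y c) * of_real (exp y / (exp y + exp z))"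
    if "c = pi \<or> c = - pi" for y c
  proof -
    have "- of_real (exp y) / (- of_real (exp y) - exp (complex_of_real z)) = of_real (exp y / (exp y + exp z))"
    proof -
      have "complex_of_real (exp y) + of_real (exp z) \<noteq> 0"
        using nz[of y] by (metis of_real_add of_real_eq_0_iff)
      then show ?thesis
        using nz'[of y] by (simp add: exp_of_real divide_simps) (simp add: algebra_simps)
    qed
    then show ?thesis by (simp add: q_def hor[OF that])
  qed
  have segRe: "Re w = R" "w \<in> strip" if "w \<in> closed_segment (Complex R (- pi)) (Complex R pi)" for w R
    using that by (auto simp: closed_segment_same_Re strip_def closed_segment_eq_real_ivl)
  have segIm: "Im w = c" "w \<in> strip" if "w \<in> closed_segment (Complex a c) (Complex b c)" "c = pi \<or> c = - pi" for w a b c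
    using that by (auto simp: closed_segment_same_Im strip_def)
  have chor: "continuous_on (closed_segment (Complex a c) (Complex b c)) q" if "c = pi \<or> c = - pi" for a b c
  proof (rule cont)
    show "exp w \<noteq> exp (complex_of_real z)" if "w \<in> closed_segment (Complex a c) (Complex b c)" for w
    proof -
      have "w = Complex (Re w) c" using segIm[OF that \<open>c = pi \<or> c = - pi\<close>] by (simp add: complex_eq_iff)
      then have "exp w = - of_real (exp (Re w))" using hor[OF \<open>c = pi \<or> c = - pi\<close>] by metis
      then show ?thesis using nz'[of "Re w"] by auto
    qed
  qed (use segIm that in auto)
  have cvert: "continuous_on (closed_segment (Complex R (- pi)) (Complex R pi)) q" if "\<bar>R\<bar> > \<bar>z\<bar>" for R
    by (rule cont) (use segRe that in \<open>auto intro!: vert\<close>)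
  have main: "2 * pi * \<i> * h z = contour_integral (S R) q - contour_integral (S (- R)) q + 2 * pi * \<i> * of_real (?A R)"
    if R: "\<bar>z\<bar> < R" for R
  proof -
    have R0: "- R < R" using R by simp
    note int = contour_integrable_continuous_linepath[OF chor, of pi R "-R"] 
       contour_integrable_continuous_linepath[OF chor, of "- pi" "-R" R]
       contour_integrable_continuous_linepath[OF cvert, of R]
       contour_integrable_continuous_linepath[OF cvert[of "-R", unfolded closed_segment_commute[of "Complex (-R) (-pi)"]]]
    have "2 * pi * \<i> * h z = contour_integral (rectpath (Complex (- R) (- pi)) (Complex R pi)) q"
      using strip_Cauchy_integral[OF ana R] unfolding q_def by (metis contour_integral_unique)
    also have "\<dots> = contour_integral (linepath (Complex (- R) (- pi)) (Complex R (- pi))) q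
       + (contour_integral (S R) q + (contour_integral (linepath (Complex R pi) (Complex (- R) pi)) q
       + contour_integral (linepath (Complex (- R) pi) (Complex (- R) (- pi))) q))"
      using int R by (simp add: rectpath_def Let_def S_def valid_path_join)
    also have "contour_integral (linepath (Complex (- R) pi) (Complex (- R) (- pi))) q = - contour_integral (S (- R)) q"
      unfolding S_def
      by (rule contour_integral_reverse_linepath, subst closed_segment_commute) (use R cvert in auto)
    also have "contour_integral (linepath (Complex R pi) (Complex (- R) pi)) q
        = - contour_integral (linepath (Complex (- R) pi) (Complex R pi)) q"
      by (rule contour_integral_reverse_linepath) (use chor in auto)
    finally have 1: "2 * pi * \<i> * h z = contour_integral (S R) q - contour_integral (S (- R)) q +
        (contour_integral (linepath (Complex (- R) (- pi)) (Complex R (- pi))) q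
          - contour_integral (linepath (Complex (- R) pi) (Complex R pi)) q)"
      by simp
    have ig: "(\<lambda>y. q (Complex y c)) integrable_on {-R..R}" if "c = pi \<or> c = - pi" for c
    proof (intro integrable_continuous_real continuous_on_compose2[OF chor[OF that, of "-R" R]] continuous_intros)
      show "(\<lambda>x. Complex x c) ` {- R..R} \<subseteq> closed_segment (Complex (- R) c) (Complex R c)"
        using R0 by (auto simp: closed_segment_same_Im closed_segment_eq_real_ivl)
    qed
    have "contour_integral (linepath (Complex (- R) (- pi)) (Complex R (- pi))) q
          - contour_integral (linepath (Complex (- R) pi) (Complex R pi)) q
        = integral {-R..R} (\<lambda>y. q (Complex y (- pi)) - q (Complex y pi))"
      using ig by (simp add: contour_integral_linepath_horizontal[OF R0] integral_diff)
    also have "\<dots> = integral {-R..R} (\<lambda>y. 2 * pi * \<i> * of_real (- Im (h (Complex y pi)) / pi * (exp y / (exp y + exp z))))"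
    proof (rule integral_cong)
      fix y
      have "h (Complex y (- pi)) = cnj (h (Complex y pi))"
        using sym[of "Complex y pi"] by (simp add: strip_def complex_cnj)
      then have "h (Complex y (- pi)) - h (Complex y pi) = 2 * pi * \<i> * of_real (- Im (h (Complex y pi)) / pi)"
        by (simp add: complex_eq_iff)
      then show "q (Complex y (- pi)) - q (Complex y pi)
         = 2 * pi * \<i> * of_real (- Im (h (Complex y pi)) / pi * (exp y / (exp y + exp z)))"
        unfolding qhor[OF disjI1, OF refl] qhor[OF disjI2, OF refl] of_real_mult
          left_diff_distrib [symmetric] by (simp only: mult.assoc)
    qed
    also have "\<dots> = 2 * pi * \<i> * of_real (?A R)"
    proof -
      have "continuous_on {-R..R} (\<lambda>y. h (Complex y pi))"
        by (rule continuous_on_compose2[OF conth]) (auto simp: strip_def Complex_eq intro!: continuous_intros)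
      then have "continuous_on {-R..R} (\<lambda>y. - Im (h (Complex y pi)) / pi * (exp y / (exp y + exp z)))"
        by (intro continuous_intros) (use nz in auto)
      then have "integral {-R..R} (\<lambda>y. complex_of_real (- Im (h (Complex y pi)) / pi * (exp y / (exp y + exp z))))
          = of_real (?A R)"
        by (intro integral_unique has_integral_of_real integrable_integral integrable_continuous_real)
      then show ?thesis by (simp only: integral_mult_right)
    qed
    finally show ?thesis using 1 by simp
  qed
  have AR: "?A R = Re (h z) - Re ((contour_integral (S R) q - contour_integral (S (- R)) q) / (2 * pi * \<i>))"
    if "\<bar>z\<bar> < R" for R
  proof -
    have "of_real (?A R) = h z - (contour_integral (S R) q - contour_integral (S (- R)) q) / (2 * pi * \<i>)"
      using main[OF that] by (simp add: field_simps)
    from arg_cong[OF this, of Re] show ?thesis by (simp only: Re_complex_of_real minus_complex.simps)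
  qed
  have ev: "eventually (\<lambda>R. Re (h z) - Re ((contour_integral (S R) q - contour_integral (S (- R)) q) / (2 * pi * \<i>)) = ?A R) at_top"
    using eventually_gt_at_top[of "\<bar>z\<bar>"] by (rule eventually_mono) (rule AR[symmetric])
  \<comment> \<open>The Cauchy factor tends to \<open>1\<close> at \<open>strip_top\<close> and is
    asymptotic to \<open>- exp w / exp z\<close> at \<open>strip_bot\<close>. This explains the
    factor \<open>exp u\<close> in \<open>bot\<close> and its absence in \<open>top\<close>.\<close>
  have qtop: "(q \<longlongrightarrow> 0) strip_top"
  proof -
    have "((\<lambda>w. norm (exp (of_real z - w))) \<longlongrightarrow> 0) strip_top"
    proof (simp, rule filterlim_compose[OF _ filterlim_Re_strip_top])
      show "((\<lambda>x. exp (z - x)) \<longlongrightarrow> 0) at_top" by real_asymp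
    qed
    then have "((\<lambda>w. h w * (1 / (1 - exp (of_real z - w)))) \<longlongrightarrow> 0 * (1 / (1 - 0))) strip_top"
      by (intro tendsto_intros top) (auto intro: tendsto_norm_zero_cancel)
    moreover have "1 / (1 - exp (of_real z - w)) = exp w / (exp w - exp (complex_of_real z))" for w
    proof -
      have "exp (complex_of_real z) = exp (of_real z - w) * exp w" by (simp add: exp_diff)
      then have "exp w - exp (complex_of_real z) = (1 - exp (of_real z - w)) * exp w"
        by (simp add: algebra_simps)
      then show ?thesis by simp
    qed
    ultimately show ?thesis by (simp add: q_def [abs_def])
  qed
  have qbot: "(q \<longlongrightarrow> 0) strip_bot"
  proof -
    have "((\<lambda>w. norm (exp w :: complex)) \<longlongrightarrow> 0) strip_bot"
      using filterlim_compose[OF exp_at_bot filterlim_Re_strip_bot] by simp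
    then have "((\<lambda>w. h w * exp w * (1 / (exp w - exp (complex_of_real z)))) \<longlongrightarrow> 0 * (1 / (0 - exp (complex_of_real z)))) strip_bot"
      by (intro tendsto_intros bot) (auto intro: tendsto_norm_zero_cancel)
    then show ?thesis by (simp add: q_def [abs_def])
  qed
  have len: "norm (Complex R pi - Complex R (- pi)) \<le> 2 * pi" for R
    by (simp add: cmod_def real_sqrt_mult)
  have "((\<lambda>R. contour_integral (S R) q) \<longlongrightarrow> 0) at_top"
    unfolding S_def
  proof (rule contour_integral_linepath_tendsto_0[OF qtop _ _ len])
    fix P assume "eventually P strip_top"
    then obtain Q where Q: "eventually Q at_top" "\<And>w. w \<in> strip \<Longrightarrow> Q (Re w) \<Longrightarrow> P w"
      by (auto simp: strip_top_def eventually_inf_principal eventually_filtercomap) 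
    from Q(1) show "eventually (\<lambda>R. \<forall>w\<in>closed_segment (Complex R (- pi)) (Complex R pi). P w) at_top"
      by eventually_elim (use segRe Q(2) in blast)
  next
    show "eventually (\<lambda>R. continuous_on (closed_segment (Complex R (- pi)) (Complex R pi)) q) at_top"
      using eventually_gt_at_top[of "\<bar>z\<bar>"] by eventually_elim (auto intro: cvert)
  qed
  moreover have "((\<lambda>R. contour_integral (S R) q) \<longlongrightarrow> 0) at_bot"
    unfolding S_def
  proof (rule contour_integral_linepath_tendsto_0[OF qbot _ _ len])
    fix P assume "eventually P strip_bot"
    then obtain Q where Q: "eventually Q at_bot" "\<And>w. w \<in> strip \<Longrightarrow> Q (Re w) \<Longrightarrow> P w"
      by (auto simp: strip_bot_def eventually_inf_principal eventually_filtercomap) 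
    from Q(1) show "eventually (\<lambda>R. \<forall>w\<in>closed_segment (Complex R (- pi)) (Complex R pi). P w) at_bot"
      by eventually_elim (use segRe Q(2) in blast)
  next
    show "eventually (\<lambda>R. continuous_on (closed_segment (Complex R (- pi)) (Complex R pi)) q) at_bot"
      using eventually_gt_at_bot[of "- \<bar>z\<bar>"] by eventually_elim (auto intro: cvert)
  qed
  then have "((\<lambda>R. contour_integral (S (- R)) q) \<longlongrightarrow> 0) at_top"
    by (rule filterlim_compose[OF _ filterlim_uminus_at_bot_at_top])
  ultimately have "((\<lambda>R. Re (h z) - Re ((contour_integral (S R) q - contour_integral (S (- R)) q) / (2 * pi * \<i>)))
      \<longlongrightarrow> Re (h z) - Re ((0 - 0) / (2 * pi * \<i>))) at_top"
    by (intro tendsto_intros) auto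
  then show ?thesis
    using ev by (auto intro: Lim_transform_eventually)
qed

text \<open>\<open>stieltjes_limit\<close> yields only a limit over symmetric intervals. The sign
  condition makes these integrals increase, so monotone convergence gives the full integral and its
  finiteness without any bound on \<open>Im h\<close>.\<close>

lemma stieltjes_representation:
  assumes ana: "h analytic_on strip"
    and sym: "\<And>u. u \<in> strip \<Longrightarrow> h (cnj u) = cnj (h u)"
    and top: "(h \<longlongrightarrow> 0) strip_top"
    and bot: "((\<lambda>u. h u * exp u) \<longlongrightarrow> 0) strip_bot"
    and Im: "\<And>y. Im (h (Complex y pi)) \<le> 0"
  shows "continuous_on UNIV (\<lambda>y. - Im (h (Complex y pi)) / pi)"
    and "(\<integral>\<^sup>+y. ennreal (- Im (h (Complex y pi)) / pi * (exp y / (exp y + exp z))) \<partial>lborel)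
           = ennreal (Re (h (of_real z)))"
proof -
  define f where "f y = - Im (h (Complex y pi)) / pi * (exp y / (exp y + exp z))" for y
  have nz: "exp y + exp z \<noteq> 0" for y :: real
    using exp_gt_zero[of y] exp_gt_zero[of z] by linarith
  have nonneg: "0 \<le> f y" for y
    unfolding f_def using Im[of y]
    by (intro mult_nonneg_nonneg divide_nonneg_nonneg add_nonneg_nonneg) auto
  have "continuous_on UNIV (\<lambda>y. h (Complex y pi))"
    by (rule continuous_on_compose2[OF holomorphic_on_imp_continuous_on[OF analytic_imp_holomorphic[OF ana]]])
       (auto simp: strip_def Complex_eq intro!: continuous_intros)
  then show cont: "continuous_on UNIV (\<lambda>y. - Im (h (Complex y pi)) / pi)"
    by (intro continuous_intros) auto
  have contf: "continuous_on UNIV f"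
    unfolding f_def by (intro continuous_intros cont) (use nz in auto)
  then have meas: "f \<in> borel_measurable borel"
    by (rule borel_measurable_continuous_onI)
  let ?I = "\<lambda>n::nat. ennreal (integral {- real n..real n} f)"
  have int: "(\<integral>\<^sup>+y. ennreal (f y) * indicator {- real n..real n} y \<partial>lborel) = ?I n" for n
    by (intro nn_integral_has_integral_lebesgue' nonneg integrable_integral integrable_continuous_real
          continuous_on_subset[OF contf]) auto
  have inc: "incseq (\<lambda>n y. ennreal (f y) * indicator {- real n..real n} y)"
    by (auto simp: incseq_def le_fun_def indicator_def)
  have "(\<integral>\<^sup>+y. ennreal (f y) \<partial>lborel) = (\<integral>\<^sup>+y. (SUP n. ennreal (f y) * indicator {- real n..real n} y) \<partial>lborel)"
  proof (intro nn_integral_cong antisym)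
    fix y :: real
    obtain n :: nat where "\<bar>y\<bar> \<le> n" using real_arch_simple by blast
    then have "ennreal (f y) = ennreal (f y) * indicator {- real n..real n} y" by (auto simp: abs_le_iff)
    also have "\<dots> \<le> (SUP n. ennreal (f y) * indicator {- real n..real n} y)" by (rule SUP_upper) simp
    finally show "ennreal (f y) \<le> \<dots>" .
    show "(SUP n. ennreal (f y) * indicator {- real n..real n} y) \<le> ennreal (f y)"
      by (rule SUP_least) (auto simp: indicator_def)
  qed
  also have "\<dots> = (SUP n. ?I n)"
    using meas by (subst nn_integral_monotone_convergence_SUP[OF inc]) (simp_all add: int)
  also have "\<dots> = ennreal (Re (h z))"
  proof (rule LIMSEQ_unique)
    have "incseq ?I"
      unfolding int[symmetric] using inc by (auto simp: incseq_def le_fun_def intro!: nn_integral_mono)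
    then show "?I \<longlonglongrightarrow> (SUP n. ?I n)" by (rule LIMSEQ_SUP)
    have "(\<lambda>n. integral {- real n..real n} f) \<longlonglongrightarrow> Re (h z)"
      using filterlim_compose[OF stieltjes_limit[OF ana sym top bot, of z] filterlim_real_sequentially]
      unfolding f_def .
    then show "?I \<longlonglongrightarrow> ennreal (Re (h z))" by (rule tendsto_ennrealI)
  qed
  finally show "(\<integral>\<^sup>+y. ennreal (- Im (h (Complex y pi)) / pi * (exp y / (exp y + exp z))) \<partial>lborel)
           = ennreal (Re (h (of_real z)))" by (simp add: f_def)
qed

section \<open>Laplace transforms with Stieltjes measures\<close>

text \<open>\<open>(s * t) ^ m / fact m\<close> is a single term of the series of
  \<open>exp (s * t)\<close>.\<close>

lemma power_mult_exp_le:
  fixes s t :: real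
  assumes "0 \<le> s" "0 < t"
  shows "s ^ m * exp (- s * t) \<le> fact m / t ^ m"
proof -
  have "(s * t) ^ m / fact m \<le> exp (s * t)"
  proof -
    have "(s * t) ^ m / fact m = (\<Sum>n\<in>{m}. inverse (fact n) *\<^sub>R (s * t) ^ n)"
      by (simp add: divide_inverse)
    also have "\<dots> \<le> (\<Sum>n. inverse (fact n) *\<^sub>R (s * t) ^ n)"
      by (rule sum_le_suminf) (use assms summable_exp_generic[of "s * t"] in auto)
    finally show ?thesis by (simp add: exp_def)
  qed
  then show ?thesis
    using assms by (simp add: exp_minus field_simps power_mult_distrib)
qed

lemma abs_exp_minus_1_minus_le:
  fixes x :: real
  shows "\<bar>exp x - 1 - x\<bar> \<le> x\<^sup>2 * exp \<bar>x\<bar>"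
proof -
  obtain t where t: "\<bar>t\<bar> \<le> \<bar>x\<bar>" "exp x = (\<Sum>m<2. (x ^ m) / fact m) + (exp t / fact 2) * x ^ 2"
    using Maclaurin_exp_le[of x 2] by auto
  then have "\<bar>exp x - 1 - x\<bar> = exp t / 2 * x\<^sup>2"
    by (simp add: numeral_2_eq_2)
  also have "\<dots> \<le> exp \<bar>x\<bar> * x\<^sup>2"
  proof (intro mult_right_mono)
    have "exp t \<le> exp \<bar>x\<bar>" using t(1) by simp
    then show "exp t / 2 \<le> exp \<bar>x\<bar>" using exp_gt_zero[of t] by linarith
  qed simp
  finally show ?thesis by (simp add: mult.commute)
qed

lemma nn_integral_exp_greaterThan:
  fixes c :: real
  assumes "0 < c"
  shows "(\<integral>\<^sup>+t. ennreal (exp (- c * t)) * indicator {0<..} t \<partial>lborel) = ennreal (1 / c)"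
proof -
  have "(\<integral>\<^sup>+t. ennreal (exp (- c * t)) * indicator {0<..} t \<partial>lborel)
      = (\<integral>\<^sup>+t. ennreal (exp (- c * t)) * indicator {0..} t \<partial>lborel)"
    using AE_lborel_singleton[of 0] by (intro nn_integral_cong_AE) (auto simp: indicator_def)
  also have "\<dots> = 0 - (- exp (- c * 0) / c)"
  proof (rule nn_integral_FTC_atLeast)
    show "((\<lambda>t. - exp (- c * t) / c) has_real_derivative exp (- c * t)) (at t)" for t
      using assms by (auto intro!: derivative_eq_intros)
    have "((\<lambda>t. exp (- c * t)) \<longlongrightarrow> 0) at_top"
      by (rule filterlim_compose[OF exp_at_bot])
         (use assms filterlim_tendsto_neg_mult_at_bot[OF tendsto_const _ filterlim_ident, of "- c"] in simp)
    then show "((\<lambda>t. - exp (- c * t) / c) \<longlongrightarrow> 0) at_top"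
      using tendsto_divide[OF tendsto_minus tendsto_const, of "\<lambda>t. exp (- c * t)" 0 at_top c] assms by simp
  qed auto
  finally show ?thesis by simp
qed

text \<open>The measure lives on the logarithmic scale: \<open>y\<close> stands for the exponential \<open>exp (- s * t)\<close> with \<open>s = exp y\<close>.\<close>

locale stieltjes_measure =
  fixes M :: "real measure"
  assumes sets_M [measurable_cong]: "sets M = sets borel"
    and sigma_finite_M: "sigma_finite_measure M"
    and finite_M: "(\<integral>\<^sup>+y. ennreal (1 / (1 + exp y)) \<partial>M) < \<infinity>"
begin

sublocale sigma_finite_measure M by (rule sigma_finite_M)

sublocale pair_sigma_finite M lborel ..

definition kernel_deriv :: "nat \<Rightarrow> real \<Rightarrow> real" where
  "kernel_deriv k t = (LINT y|M. (- exp y) ^ k * exp (- exp y * t))"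

text \<open>The value \<open>0\<close> at nonpositive arguments confines a product
  \<open>k (t - s) * l s\<close> of two such kernels to \<open>0 \<le> s \<le> t\<close>, so that
  convolutions and transforms may be taken over the whole line.\<close>

definition kernel :: "real \<Rightarrow> real" where
  "kernel t = (if 0 < t then kernel_deriv 0 t else 0)"

lemma integrable_base: "integrable M (\<lambda>y. 1 / (1 + exp y))"
  using finite_M by (intro integrableI_nonneg) (auto intro: add_nonneg_nonneg)

lemma integrable_kernel_pos:
  assumes "0 < t"
  shows "integrable M (\<lambda>y. exp y ^ k * exp (- exp y * t))"
proof (rule Bochner_Integration.integrable_bound)
  \<comment> \<open>Comparison with \<open>1 / (1 + exp y)\<close> needs a bound for
    \<open>s ^ k * exp (- s * t) * (1 + s)\<close> with \<open>s = exp y\<close>; the summands come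
    from the exponents \<open>k\<close> and \<open>Suc k\<close>.\<close>
  let ?C = "fact k / t ^ k + fact (Suc k) / t ^ Suc k"
  show "integrable M (\<lambda>y. ?C * (1 / (1 + exp y)))"
    by (intro integrable_mult_right integrable_base)
  show "AE y in M. norm (exp y ^ k * exp (- exp y * t)) \<le> norm (?C * (1 / (1 + exp y)))"
  proof (rule AE_I2)
    fix y
    have "exp y ^ k * exp (- exp y * t) + exp y ^ Suc k * exp (- exp y * t) \<le> ?C"
      by (intro add_mono power_mult_exp_le assms) auto
    then have "exp y ^ k * exp (- exp y * t) * (1 + exp y) \<le> ?C"
      by (simp add: algebra_simps)
    then have "exp y ^ k * exp (- exp y * t) \<le> ?C * (1 / (1 + exp y))"
      by (simp add: pos_le_divide_eq add_pos_pos)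
    also have "\<dots> \<le> norm (?C * (1 / (1 + exp y)))"
      by (simp only: real_norm_def abs_ge_self)
    finally show "norm (exp y ^ k * exp (- exp y * t)) \<le> norm (?C * (1 / (1 + exp y)))"
      by (simp add: abs_mult)
  qed
qed measurable

lemma integrable_kernel_deriv:
  assumes "0 < t"
  shows "integrable M (\<lambda>y. (- exp y) ^ k * exp (- exp y * t))"
  using integrable_mult_right[OF integrable_kernel_pos[OF assms], of "(- 1) ^ k" k]
  by (simp add: power_minus[of "exp _"] mult.assoc)

text \<open>Differentiation under the integral with an error linear in \<open>h\<close>, obtained
  from the second-order Taylor remainder of \<open>exp (- s * h)\<close>.\<close>

lemma DERIV_kernel_deriv:
  assumes t: "0 < t"
  shows "(kernel_deriv k has_real_derivative kernel_deriv (Suc k) t) (at t)"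
proof -
  \<comment> \<open>The remainder costs \<open>s\<^sup>2\<close> and a factor
    \<open>exp (s * |h|)\<close>. For \<open>|h| < t / 2\<close> half of the decay
    \<open>exp (- s * t)\<close> absorbs the latter, and the other half stays in
    \<open>B\<close>.\<close>
  define B where "B = (LINT y|M. exp y ^ (k + 2) * exp (- exp y * (t / 2)))"
  have bound: "\<bar>(kernel_deriv k (t + h) - kernel_deriv k t) / h - kernel_deriv (Suc k) t\<bar> \<le> \<bar>h\<bar> * B"
    if h: "h \<noteq> 0" "\<bar>h\<bar> < t / 2" for h
  proof -
    have th: "0 < t + h" "0 < t / 2" using h t by auto
    note int = integrable_kernel_deriv[OF t] integrable_kernel_deriv[OF th(1)]
    let ?g = "\<lambda>y. ((- exp y) ^ k * exp (- exp y * (t + h)) - (- exp y) ^ k * exp (- exp y * t)) / h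
      - (- exp y) ^ Suc k * exp (- exp y * t)"
    have eq: "(kernel_deriv k (t + h) - kernel_deriv k t) / h - kernel_deriv (Suc k) t = (LINT y|M. ?g y)"
      unfolding kernel_deriv_def using int[of k] int[of "Suc k"] 
      by (subst (1 2) Bochner_Integration.integral_diff [symmetric] | subst integral_divide_zero[symmetric]
          | intro Bochner_Integration.integrable_diff integrable_divide_zero impI | simp)+
    have "\<bar>LINT y|M. ?g y\<bar> \<le> (LINT y|M. \<bar>h\<bar> * (exp y ^ (k + 2) * exp (- exp y * (t / 2))))"
    proof (rule integral_abs_bound_integral)
      show "integrable M ?g"
        by (intro Bochner_Integration.integrable_diff integrable_divide_zero impI int)
      show "integrable M (\<lambda>y. \<bar>h\<bar> * (exp y ^ (k + 2) * exp (- exp y * (t / 2))))"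
        by (intro integrable_mult_right integrable_kernel_pos th)
      fix y
      define s :: real where "s = exp y"
      have "0 < s" by (simp add: s_def)
      have "?g y = (- s) ^ k * exp (- s * t) * ((exp (- s * h) - 1 - (- s * h)) / h)"
        using h(1) by (simp add: s_def field_simps flip: exp_add)
      then have "\<bar>?g y\<bar> = s ^ k * exp (- s * t) * (\<bar>exp (- s * h) - 1 - (- s * h)\<bar> / \<bar>h\<bar>)"
        using \<open>0 < s\<close> by (simp add: abs_mult power_abs)
      also have "\<dots> \<le> s ^ k * exp (- s * t) * (((- s * h)\<^sup>2 * exp \<bar>- s * h\<bar>) / \<bar>h\<bar>)"
        using \<open>0 < s\<close> by (intro mult_left_mono divide_right_mono abs_exp_minus_1_minus_le) auto
      also have "((- s * h)\<^sup>2 * exp \<bar>- s * h\<bar>) / \<bar>h\<bar> = \<bar>h\<bar> * s\<^sup>2 * exp (s * \<bar>h\<bar>)"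
        using h(1) \<open>0 < s\<close> by (simp add: power_mult_distrib abs_mult field_simps) (simp add: power2_eq_square abs_mult_self_eq)
      also have "s ^ k * exp (- s * t) * (\<bar>h\<bar> * s\<^sup>2 * exp (s * \<bar>h\<bar>))
          \<le> s ^ k * exp (- s * t) * (\<bar>h\<bar> * s\<^sup>2 * exp (s * (t / 2)))"
        using h \<open>0 < s\<close> by (intro mult_left_mono) (auto intro!: mult_left_mono)
      also have "s ^ k * exp (- s * t) * (\<bar>h\<bar> * s\<^sup>2 * exp (s * (t / 2))) = \<bar>h\<bar> * (s ^ (k + 2) * exp (- s * (t / 2)))"
      proof -
        have "exp (- s * t) * exp (s * (t / 2)) = exp (- s * (t / 2))"
          by (simp flip: exp_add)
        then show ?thesis by (simp add: power_add power2_eq_square mult_ac)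
      qed
      finally show "\<bar>?g y\<bar> \<le> \<bar>h\<bar> * (exp y ^ (k + 2) * exp (- exp y * (t / 2)))"
        by (simp only: s_def)
    qed
    also have "\<dots> = \<bar>h\<bar> * B" unfolding B_def by (rule integral_mult_right_zero)
    finally show ?thesis unfolding eq .
  qed
  have "((\<lambda>h. (kernel_deriv k (t + h) - kernel_deriv k t) / h - kernel_deriv (Suc k) t) \<longlongrightarrow> 0) (at 0)"
  proof (rule Lim_null_comparison)
    have "eventually (\<lambda>h. \<bar>h\<bar> < t / 2) (at (0::real))"
      using t by (auto simp: eventually_at intro!: exI[of _ "t / 2"])
    moreover have "eventually (\<lambda>h. h \<noteq> 0) (at (0::real))"
      by (simp add: eventually_at_filter)
    ultimately show "eventually (\<lambda>h. norm ((kernel_deriv k (t + h) - kernel_deriv k t) / h - kernel_deriv (Suc k) t) \<le> \<bar>h\<bar> * B) (at 0)"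
      by eventually_elim (use bound in auto)
    show "((\<lambda>h. \<bar>h\<bar> * B) \<longlongrightarrow> 0) (at 0)"
      by (auto intro!: tendsto_eq_intros)
  qed
  then show ?thesis
    unfolding DERIV_def by (rule LIM_zero_cancel)
qed

lemma deriv_iter_kernel: "0 < t \<Longrightarrow> (deriv ^^ n) kernel t = kernel_deriv n t"
proof (induction n arbitrary: t)
  case (Suc n)
  have "((deriv ^^ n) kernel has_real_derivative kernel_deriv (Suc n) t) (at t)"
    by (rule has_field_derivative_transform_within_open[OF DERIV_kernel_deriv[OF Suc.prems], of "{0<..}"])
       (use Suc in auto)
  then show ?case by (auto dest: DERIV_imp_deriv)
qed (simp add: kernel_def)

lemma kernel_CM: "kernel \<in> CM"
  unfolding CM_def
proof (intro CollectI allI impI conjI)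
  fix n and t :: real assume t: "0 < t"
  have "((deriv ^^ n) kernel has_real_derivative kernel_deriv (Suc n) t) (at t)"
    by (rule has_field_derivative_transform_within_open[OF DERIV_kernel_deriv[OF t], of "{0<..}"])
       (use t deriv_iter_kernel in auto)
  then show "(deriv ^^ n) kernel field_differentiable at t"
    by (auto simp: field_differentiable_def)
  have "(- 1) ^ n * ((- exp y) ^ n * c) = exp y ^ n * c" for y c :: real
  proof -
    have "(- 1) ^ n * ((- exp y) ^ n * c) = ((- 1) * (- exp y)) ^ n * c"
      by (simp only: power_mult_distrib mult.assoc)
    then show ?thesis by simp
  qed
  then have "(- 1) ^ n * kernel_deriv n t = (LINT y|M. exp y ^ n * exp (- exp y * t))"
    unfolding kernel_deriv_def by (simp only: integral_mult_right_zero [symmetric])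
  then show "0 \<le> (- 1) ^ n * (deriv ^^ n) kernel t"
    using t by (simp add: deriv_iter_kernel)
qed

lemma kernel_nonneg: "0 \<le> kernel t"
  by (auto simp: kernel_def kernel_deriv_def)

lemma kernel_nonpos: "t \<le> 0 \<Longrightarrow> kernel t = 0"
  by (simp add: kernel_def)

lemma kernel_antimono: "antimono_on {0<..} kernel"
proof (rule monotone_onI)
  fix s t :: real assume "s \<in> {0<..}" "t \<in> {0<..}" "s \<le> t"
  then show "kernel t \<le> kernel s"
    using integrable_kernel_deriv[of s 0] integrable_kernel_deriv[of t 0]
    by (auto simp: kernel_def kernel_deriv_def intro!: integral_mono)
qed

lemma kernel_continuous: "continuous_on {0<..} kernel"
  unfolding kernel_def
  by (rule continuous_on_eq[of _ "kernel_deriv 0"])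
     (auto intro!: continuous_at_imp_continuous_on DERIV_isCont[OF DERIV_kernel_deriv])

lemma kernel_measurable [measurable]: "kernel \<in> borel_measurable borel"
  unfolding kernel_def kernel_deriv_def by measurable

text \<open>By Tonelli each exponential contributes its own transform
  \<open>1 / (exp y + z)\<close>, so the result is the Stieltjes transform of
  \<open>M\<close>.\<close>

lemma nn_integral_kernel:
  assumes "0 < z"
  shows "(\<integral>\<^sup>+t. ennreal (exp (- z * t) * kernel t) \<partial>lborel) = (\<integral>\<^sup>+y. ennreal (1 / (exp y + z)) \<partial>M)"
proof -
  let ?f = "\<lambda>y t. ennreal (exp (- (exp y + z) * t)) * indicator {0<..} t"
  have "(\<integral>\<^sup>+t. ennreal (exp (- z * t) * kernel t) \<partial>lborel) = (\<integral>\<^sup>+t. (\<integral>\<^sup>+y. ?f y t \<partial>M) \<partial>lborel)"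
  proof (rule nn_integral_cong)
    fix t :: real
    show "ennreal (exp (- z * t) * kernel t) = (\<integral>\<^sup>+y. ?f y t \<partial>M)"
    proof (cases "0 < t")
      case True
      have "exp (- z * t) * kernel t = (LINT y|M. exp (- (exp y + z) * t))"
        using True unfolding kernel_def kernel_deriv_def
        by (simp add: algebra_simps flip: exp_add integral_mult_right_zero)
      moreover have "integrable M (\<lambda>y. exp (- (exp y + z) * t))"
        using integrable_mult_right[OF integrable_kernel_deriv[OF True, of 0], of "exp (- z * t)"]
        by (simp add: algebra_simps flip: exp_add)
      ultimately show ?thesis
        using True by (simp add: nn_integral_eq_integral)
    qed (simp add: kernel_def)
  qed
  also have "\<dots> = (\<integral>\<^sup>+y. (\<integral>\<^sup>+t. ?f y t \<partial>lborel) \<partial>M)"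
    by (rule Fubini') measurable
  also have "\<dots> = (\<integral>\<^sup>+y. ennreal (1 / (exp y + z)) \<partial>M)"
  proof (rule nn_integral_cong)
    fix y
    define c where "c = exp y + z"
    have "0 < c" using assms by (simp add: c_def add_pos_pos)
    then show "(\<integral>\<^sup>+t. ?f y t \<partial>lborel) = ennreal (1 / (exp y + z))"
      unfolding c_def by (rule nn_integral_exp_greaterThan)
  qed
  finally show ?thesis .
qed

end

section \<open>Convolution and uniqueness of Laplace transforms\<close>

text \<open>Under \<open>x = exp (- t)\<close> vanishing moments annihilate all polynomials in
  \<open>x\<close>, and the Weierstrass theorem passes to continuous \<open>g\<close>. The support
  condition keeps \<open>x\<close> in the compact interval from \<open>0\<close> to
  \<open>1\<close>.\<close>

lemma lerch_continuous_test:
  fixes m :: "real \<Rightarrow> real" and g :: "real \<Rightarrow> real"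
  assumes int: "integrable lborel m" and supp: "\<And>t. t \<le> 0 \<Longrightarrow> m t = 0"
    and mom: "\<And>n. (LINT t|lborel. exp (- t) ^ n * m t) = 0"
    and g: "continuous_on UNIV g"
  shows "integrable lborel (\<lambda>t. g (exp (- t)) * m t)" and "(LINT t|lborel. g (exp (- t)) * m t) = 0"
proof -
  have intc: "integrable lborel (\<lambda>t. h (exp (- t)) * m t)" if h: "continuous_on UNIV h" for h :: "real \<Rightarrow> real"
  proof -
    have "bounded (h ` {0..1})"
      by (intro compact_imp_bounded compact_continuous_image continuous_on_subset[OF h]) auto
    then obtain C where C: "\<forall>x\<in>{0..1}. \<bar>h x\<bar> \<le> C"
      unfolding bounded_iff by auto
    have [measurable]: "h \<in> borel_measurable borel" by (rule borel_measurable_continuous_onI[OF h])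
    have [measurable]: "m \<in> borel_measurable borel" using borel_measurable_integrable[OF int] by simp
    show ?thesis
    proof (rule Bochner_Integration.integrable_bound[OF integrable_mult_right[OF int, of C]])
      show "AE t in lborel. norm (h (exp (- t)) * m t) \<le> norm (C * m t)"
      proof (rule AE_I2)
        fix t :: real
        show "norm (h (exp (- t)) * m t) \<le> norm (C * m t)"
          using supp[of t] C[rule_format, of "exp (- t)"] by (cases "t \<le> 0") (auto simp: abs_mult intro!: mult_right_mono)
      qed
    qed measurable
  qed
  show "integrable lborel (\<lambda>t. g (exp (- t)) * m t)" by (rule intc[OF g])
  define A where "A = (LINT t|lborel. \<bar>m t\<bar>)"
  have bound: "\<bar>LINT t|lborel. g (exp (- t)) * m t\<bar> \<le> e * A" if "0 < e" for e
  proof -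
    obtain p where p: "real_polynomial_function p" "\<And>x. x \<in> {0..1} \<Longrightarrow> \<bar>g x - p x\<bar> < e"
      using Stone_Weierstrass_real_polynomial_function[of "{0..1::real}" g e] \<open>0 < e\<close> continuous_on_subset[OF g]
      by auto
    obtain a N where pa: "p = (\<lambda>x. \<Sum>i\<le>N. a i * x ^ i)"
      using p(1) by (auto simp: real_polynomial_function_iff_sum)
    have contp: "continuous_on UNIV p" unfolding pa by (intro continuous_intros)
    have "(LINT t|lborel. p (exp (- t)) * m t) = (\<Sum>i\<le>N. LINT t|lborel. a i * (exp (- t) ^ i * m t))"
      unfolding pa sum_distrib_right mult.assoc
      by (rule Bochner_Integration.integral_sum) (auto intro!: integrable_mult_right intc[where h = "\<lambda>x. x ^ _"] continuous_intros)
    also have "\<dots> = 0" by (simp only: integral_mult_right_zero mom) simp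
    finally have "(LINT t|lborel. g (exp (- t)) * m t) = (LINT t|lborel. g (exp (- t)) * m t - p (exp (- t)) * m t)"
      using intc[OF g] intc[OF contp] by simp
    also have "\<bar>\<dots>\<bar> \<le> (LINT t|lborel. e * \<bar>m t\<bar>)"
    proof (rule integral_abs_bound_integral)
      fix t :: real
      have "\<bar>g (exp (- t)) - p (exp (- t))\<bar> * \<bar>m t\<bar> \<le> e * \<bar>m t\<bar>"
        using supp[of t] p(2)[of "exp (- t)"] by (cases "t \<le> 0") (auto intro!: mult_right_mono)
      then show "\<bar>g (exp (- t)) * m t - p (exp (- t)) * m t\<bar> \<le> e * \<bar>m t\<bar>"
        by (simp add: abs_mult left_diff_distrib [symmetric])
    qed (use int intc[OF g] intc[OF contp] in auto)
    finally show ?thesis by (simp add: A_def)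
  qed
  have "0 \<le> A" by (simp add: A_def)
  have "\<bar>LINT t|lborel. g (exp (- t)) * m t\<bar> \<le> 0"
  proof (rule field_le_epsilon)
    \<comment> \<open>\<open>bound\<close> is applied to \<open>e / (A + 1)\<close>, which also
      covers \<open>A = 0\<close>.\<close>
    fix e :: real assume "0 < e"
    have "\<bar>LINT t|lborel. g (exp (- t)) * m t\<bar> \<le> e / (A + 1) * A"
      using \<open>0 < e\<close> \<open>0 \<le> A\<close> by (intro bound) auto
    also have "\<dots> \<le> e" using \<open>0 < e\<close> \<open>0 \<le> A\<close> by (simp add: field_simps)
    finally show "\<bar>LINT t|lborel. g (exp (- t)) * m t\<bar> \<le> 0 + e" by simp
  qed
  then show "(LINT t|lborel. g (exp (- t)) * m t) = 0" by simp
qed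

text \<open>The weight \<open>exp (- t)\<close> shifts the moments, so only transforms at the
  positive integers enter. If \<open>f t0\<close> were nonzero, continuity would give a
  neighbourhood of constant sign, and a test function living there would have a nonzero
  integral.\<close>

lemma lerch:
  fixes f :: "real \<Rightarrow> real"
  assumes int: "integrable lborel (\<lambda>t. indicator {0<..} t * (exp (- t) * f t))"
    and mom: "\<And>n. (LINT t|lborel. exp (- t) ^ n * (indicator {0<..} t * (exp (- t) * f t))) = 0"
    and cont: "continuous_on {0<..} f" and t0: "0 < t0"
  shows "f t0 = 0"
proof (rule ccontr)
  assume nz: "f t0 \<noteq> 0"
  define m where "m t = indicator {0<..} t * (exp (- t) * f t)" for t
  define a where "a = sgn (f t0)"
  have "isCont (\<lambda>t. a * f t) t0"
    using cont t0 by (intro continuous_intros) (auto simp: continuous_on_eq_continuous_at)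
  moreover have "0 < a * f t0" using nz by (simp add: a_def sgn_if)
  ultimately have "eventually (\<lambda>t. 0 < a * f t) (nhds t0)"
    unfolding isCont_def tendsto_at_iff_tendsto_nhds[of "\<lambda>t. a * f t" t0] by (rule order_tendstoD)
  moreover have "eventually (\<lambda>t. 0 < t) (nhds t0)"
    using t0 by (intro order_tendstoD(1)[OF filterlim_ident])
  ultimately have ev: "eventually (\<lambda>t. 0 < t \<and> 0 < a * f t) (nhds t0)"
    by eventually_elim simp
  define x0 where "x0 = exp (- t0)"
  have "((\<lambda>x. - ln x) \<longlongrightarrow> - ln x0) (nhds x0)"
    unfolding tendsto_at_iff_tendsto_nhds[of "\<lambda>x. - ln x" x0, symmetric] by (intro tendsto_intros) (simp_all add: x0_def)
  then have "filterlim (\<lambda>x. - ln x) (nhds t0) (nhds x0)" by (simp add: x0_def)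
  with ev have "eventually (\<lambda>x. 0 < - ln x \<and> 0 < a * f (- ln x)) (nhds x0)"
    by (auto simp: filterlim_iff)
  then obtain r where r: "0 < r" "\<And>x. \<bar>x - x0\<bar> < r \<Longrightarrow> 0 < - ln x \<and> 0 < a * f (- ln x)"
    by (auto simp: eventually_nhds_metric dist_real_def)
  have pos: "0 < t \<and> 0 < a * f t" if "\<bar>exp (- t) - x0\<bar> < r" for t
    using r(2)[OF that] by simp
  \<comment> \<open>A tent around \<open>x0\<close>, times the sign of \<open>f t0\<close>. It
    vanishes outside the region where \<open>a * f\<close> is positive, so its product with
    \<open>m\<close> is nonnegative everywhere and positive near \<open>t0\<close>.\<close>
  define g where "g x = max 0 (r - \<bar>x - x0\<bar>) * a" for x
  have contg: "continuous_on UNIV g" unfolding g_def by (intro continuous_intros)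
  have suppm: "m t = 0" if "t \<le> 0" for t using that by (simp add: m_def)
  note test = lerch_continuous_test[OF int[folded m_def] suppm mom[folded m_def] contg]
  have nonneg: "0 \<le> g (exp (- t)) * m t" for t
  proof (cases "\<bar>exp (- t) - x0\<bar> < r")
    case True
    have "g (exp (- t)) * m t = max 0 (r - \<bar>exp (- t) - x0\<bar>) * (indicator {0<..} t * exp (- t)) * (a * f t)"
      by (simp add: g_def m_def)
    then show ?thesis using pos[OF True] by (auto intro!: mult_nonneg_nonneg)
  qed (simp add: g_def)
  have "AE t in lborel. g (exp (- t)) * m t = 0"
    using integral_nonneg_eq_0_iff_AE[OF test(1)] nonneg test(2) by simp
  then have AE: "AE t in lborel. t \<notin> {t. \<bar>exp (- t) - x0\<bar> < r}"
  proof eventually_elim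
    case (elim t)
    show ?case using elim pos[of t] by (auto simp: g_def m_def)
  qed
  have op: "open {t. \<bar>exp (- t) - x0\<bar> < r}"
    by (intro open_Collect_less continuous_intros)
  then have "{t. \<bar>exp (- t) - x0\<bar> < r} \<in> null_sets lborel"
    using AE by (subst AE_iff_null_sets) auto
  then have "negligible {t. \<bar>exp (- t) - x0\<bar> < r}"
    unfolding negligible_iff_null_sets by (rule null_sets_completionI)
  moreover have "t0 \<in> {t. \<bar>exp (- t) - x0\<bar> < r}" using r(1) by (simp add: x0_def)
  ultimately show False using op open_not_negligible by blast
qed

section \<open>Convolution of two decreasing kernels\<close>

locale decreasing_kernel =
  fixes k :: "real \<Rightarrow> real"
  assumes measurable_k [measurable]: "k \<in> borel_measurable borel"
    and nonpos: "\<And>t. t \<le> 0 \<Longrightarrow> k t = 0"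
    and nonneg: "\<And>t. 0 \<le> k t"
    and cont: "continuous_on {0<..} k"
    and anti: "antimono_on {0<..} k"
    and finite_laplace: "(\<integral>\<^sup>+t. ennreal (exp (- t) * k t) \<partial>lborel) < \<infinity>"
begin

lemma antimonoD: "0 < s \<Longrightarrow> s \<le> t \<Longrightarrow> k t \<le> k s"
  using anti by (auto simp: monotone_on_def)

lemma integrable_atMost: "integrable lborel (\<lambda>t. indicator {..T} t * k t)"
proof (rule Bochner_Integration.integrable_bound)
  show "integrable lborel (\<lambda>t. exp T * (exp (- t) * k t))"
    using finite_laplace nonneg by (intro integrable_mult_right integrableI_nonneg) auto
  show "AE t in lborel. norm (indicator {..T} t * k t) \<le> norm (exp T * (exp (- t) * k t))"
  proof (rule AE_I2)
    fix t
    have "1 * k t \<le> exp (T - t) * k t" if "t \<le> T"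
      using that nonneg[of t] by (intro mult_right_mono) auto
    then show "norm (indicator {..T} t * k t) \<le> norm (exp T * (exp (- t) * k t))"
      using nonneg[of t] by (auto simp: indicator_def exp_diff exp_minus field_simps)
  qed
qed measurable

lemma locally_integrable: "locally_integrable_half_line k"
  unfolding locally_integrable_half_line_def set_integrable_def
proof (intro allI impI)
  fix T :: real
  have "(\<lambda>t. indicator {0..T} t *\<^sub>R k t) = (\<lambda>t. indicator {..T} t * k t)"
    by (auto simp: fun_eq_iff indicator_def intro: nonpos)
  then show "integrable lebesgue (\<lambda>t. indicator {0..T} t *\<^sub>R k t)"
    by (simp add: integrable_completion integrable_atMost)
qed

lemma laplace_transform_eq:
  assumes "(\<integral>\<^sup>+t. ennreal (exp (- z * t) * k t) \<partial>lborel) = ennreal r" "0 \<le> r"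
  shows "laplace_transform k z = r"
proof -
  have "laplace_transform k z = (LINT t|lebesgue. exp (- z * t) * k t)"
    unfolding laplace_transform_def set_lebesgue_integral_def
    by (rule Bochner_Integration.integral_cong) (auto simp: indicator_def nonpos)
  also have "\<dots> = (LINT t|lborel. exp (- z * t) * k t)"
    by (rule integral_completion) measurable
  also have "\<dots> = enn2real (\<integral>\<^sup>+t. ennreal (exp (- z * t) * k t) \<partial>lborel)"
    by (rule integral_eq_nn_integral) (auto simp: nonneg)
  finally show ?thesis using assms by simp
qed

end

locale kernel_pair = K: decreasing_kernel k + L: decreasing_kernel l for k l :: "real \<Rightarrow> real"
begin

lemmas [measurable] = K.measurable_k L.measurable_k

definition conv :: "real \<Rightarrow> real" where
  "conv t = (LINT s|lborel. k (t - s) * l s)"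

text \<open>\<open>l s\<close> may be singular at \<open>s = 0\<close> and \<open>k (t - s)\<close>
  at \<open>s = t\<close>. On either side of \<open>t / 2\<close> one factor is bounded by its value
  at \<open>t / 2\<close>, and the other is integrable.\<close>

lemma integrable_conv:
  assumes t: "0 < t"
  shows "integrable lborel (\<lambda>s. k (t - s) * l s)"
proof (rule Bochner_Integration.integrable_bound)
  have "integrable lborel (\<lambda>s. indicator {..t} (t - s) * k (t - s))"
    using lborel_integrable_real_affine[OF K.integrable_atMost[of t], of "-1" t] by simp
  then show "integrable lborel (\<lambda>s. k (t / 2) * (indicator {..t} s * l s) + l (t / 2) * (indicator {..t} (t - s) * k (t - s)))"
    by (intro Bochner_Integration.integrable_add integrable_mult_right L.integrable_atMost)
  show "AE s in lborel. norm (k (t - s) * l s)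
      \<le> norm (k (t / 2) * (indicator {..t} s * l s) + l (t / 2) * (indicator {..t} (t - s) * k (t - s)))"
  proof (rule AE_I2)
    fix s
    have nn: "0 \<le> k (t / 2) * l s" "0 \<le> l (t / 2) * k (t - s)"
      using K.nonneg L.nonneg by auto
    have "k (t - s) * l s \<le> k (t / 2) * l s + l (t / 2) * k (t - s)" if "0 < s" "s < t"
    proof (cases "s \<le> t / 2")
      case True
      then have "k (t - s) * l s \<le> k (t / 2) * l s"
        using t L.nonneg[of s] by (intro mult_right_mono K.antimonoD) auto
      then show ?thesis using nn by linarith
    next
      case False
      then have "k (t - s) * l s \<le> k (t - s) * l (t / 2)"
        using t K.nonneg[of "t - s"] by (intro mult_left_mono L.antimonoD) auto
      then show ?thesis using nn by (simp add: mult.commute)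
    qed
    then show "norm (k (t - s) * l s)
        \<le> norm (k (t / 2) * (indicator {..t} s * l s) + l (t / 2) * (indicator {..t} (t - s) * k (t - s)))"
      using nn K.nonneg[of "t - s"] L.nonneg[of s] K.nonpos[of "t - s"] L.nonpos[of s]
      by (cases "0 < s"; cases "s < t") (auto simp: indicator_def)
  qed
qed measurable

lemma conv_nonneg: "0 \<le> conv t"
  by (simp add: conv_def K.nonneg L.nonneg)

lemma conv_nonpos: "t \<le> 0 \<Longrightarrow> conv t = 0"
proof -
  assume "t \<le> 0"
  then have "k (t - s) * l s = 0" for s
    using K.nonpos[of "t - s"] L.nonpos[of s] by (cases "s \<le> 0") auto
  then show ?thesis by (simp only: conv_def) simp
qed

lemma conv_measurable [measurable]: "conv \<in> borel_measurable borel"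
  unfolding conv_def by measurable

text \<open>The rescaling fixes the singular points \<open>0\<close> and \<open>1\<close>, so that monotonicity provides a dominating function.\<close>

lemma conv_scaled:
  assumes "0 < t"
  shows "conv t = t * (LINT r|lborel. k (t * (1 - r)) * l (t * r))"
  unfolding conv_def using assms
  by (subst lborel_integral_real_affine[where c = t and t = 0]) (auto simp: right_diff_distrib)

lemma integrable_conv_scaled:
  assumes "0 < t"
  shows "integrable lborel (\<lambda>r. k (t * (1 - r)) * l (t * r))"
  using lborel_integrable_real_affine[OF integrable_conv[OF assms], of t 0] assms
  by (simp add: right_diff_distrib)

lemma conv_continuous: "continuous_on {0<..} conv"
proof -
  have *: "continuous_on {a..b} (\<lambda>t. LINT r|lborel. k (t * (1 - r)) * l (t * r))" if a: "0 < a" for a b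
    unfolding continuous_on_sequentially
  proof (intro allI ballI impI, unfold o_def, elim conjE)
    fix X t assume t: "t \<in> {a..b}" and X: "\<forall>n. X n \<in> {a..b}" "X \<longlonglongrightarrow> t"
    show "(\<lambda>n. LINT r|lborel. k (X n * (1 - r)) * l (X n * r)) \<longlonglongrightarrow> (LINT r|lborel. k (t * (1 - r)) * l (t * r))"
    proof (rule integral_dominated_convergence[where w = "\<lambda>r. k (a * (1 - r)) * l (a * r)"])
      show "integrable lborel (\<lambda>r. k (a * (1 - r)) * l (a * r))" by (rule integrable_conv_scaled[OF a])
      have out: "k (x * (1 - r)) * l (x * r) = 0" if "r \<le> 0 \<or> 1 \<le> r" "a \<le> x" for x r
        using that a K.nonpos[of "x * (1 - r)"] L.nonpos[of "x * r"]
        by (auto simp: mult_le_0_iff)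
      show "AE r in lborel. (\<lambda>n. k (X n * (1 - r)) * l (X n * r)) \<longlonglongrightarrow> k (t * (1 - r)) * l (t * r)"
      proof (rule AE_I2)
        fix r :: real
        show "(\<lambda>n. k (X n * (1 - r)) * l (X n * r)) \<longlonglongrightarrow> k (t * (1 - r)) * l (t * r)"
        proof (cases "r \<le> 0 \<or> 1 \<le> r")
          case True
          then have "k (t * (1 - r)) * l (t * r) = 0" "k (X n * (1 - r)) * l (X n * r) = 0" for n
            using out[OF True] X t unfolding atLeastAtMost_iff by blast+
          then show ?thesis by (simp only: tendsto_const)
        next
          case False
          then have "0 < t * (1 - r)" "0 < t * r" using a t by auto
          then have "isCont k (t * (1 - r))" "isCont l (t * r)"
            using K.cont L.cont by (auto simp: continuous_on_eq_continuous_at)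
          then show ?thesis
            by (intro tendsto_mult isCont_tendsto_compose[of _ k] isCont_tendsto_compose[of _ l] tendsto_intros X)
        qed
      qed
      show "AE r in lborel. norm (k (X n * (1 - r)) * l (X n * r)) \<le> k (a * (1 - r)) * l (a * r)" for n
      proof (rule AE_I2)
        fix r :: real
        show "norm (k (X n * (1 - r)) * l (X n * r)) \<le> k (a * (1 - r)) * l (a * r)"
        proof (cases "r \<le> 0 \<or> 1 \<le> r")
          case True
          then have "k (X n * (1 - r)) * l (X n * r) = 0"
            using out[OF True, of "X n"] X by simp
          then show ?thesis by (simp only: out[OF True order_refl] norm_zero order_refl)
        next
          case False
          then show ?thesis
            using a X(1)[rule_format, of n] K.nonneg L.nonneg
            by (auto simp: abs_mult intro!: mult_mono K.antimonoD L.antimonoD mult_right_mono)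
        qed
      qed
    qed measurable
  qed
  have "isCont conv t" if "0 < t" for t
  proof -
    \<comment> \<open>The dominating function is the integrand at the left endpoint, which must be
      positive; hence a compact interval around each \<open>t\<close>.\<close>
    have "continuous_on {t / 2..2 * t} conv"
      by (rule continuous_on_eq[OF continuous_on_mult[OF continuous_on_id *]])
         (use that in \<open>auto simp: conv_scaled\<close>)
    then show ?thesis
      using that by (intro continuous_on_interior[of "{t / 2..2 * t}"]) auto
  qed
  then show ?thesis by (auto intro: continuous_at_imp_continuous_on)
qed

lemma nn_integral_conv:
  "(\<integral>\<^sup>+t. ennreal (exp (- z * t) * conv t) \<partial>lborel) =
     (\<integral>\<^sup>+t. ennreal (exp (- z * t) * k t) \<partial>lborel) * (\<integral>\<^sup>+t. ennreal (exp (- z * t) * l t) \<partial>lborel)"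
proof -
  let ?k = "\<lambda>t. ennreal (exp (- z * t) * k t)" and ?l = "\<lambda>t. ennreal (exp (- z * t) * l t)"
  have "(\<integral>\<^sup>+t. ennreal (exp (- z * t) * conv t) \<partial>lborel) = (\<integral>\<^sup>+t. (\<integral>\<^sup>+s. ?k (t - s) * ?l s \<partial>lborel) \<partial>lborel)"
  proof (rule nn_integral_cong)
    fix t :: real
    have eq: "?k (t - s) * ?l s = ennreal (exp (- z * t)) * ennreal (k (t - s) * l s)" for s
    proof -
      have "exp (- z * (t - s)) * k (t - s) * (exp (- z * s) * l s)
          = exp (- z * (t - s) + - z * s) * (k (t - s) * l s)"
        by (simp only: exp_add mult_ac)
      also have "- z * (t - s) + - z * s = - z * t" by (simp add: algebra_simps)
      finally show ?thesis
        by (simp add: K.nonneg L.nonneg flip: ennreal_mult)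
    qed
    have "(\<integral>\<^sup>+s. ?k (t - s) * ?l s \<partial>lborel) = ennreal (exp (- z * t)) * (\<integral>\<^sup>+s. ennreal (k (t - s) * l s) \<partial>lborel)"
      unfolding eq by (rule nn_integral_cmult) measurable
    also have "(\<integral>\<^sup>+s. ennreal (k (t - s) * l s) \<partial>lborel) = ennreal (conv t)"
    proof (cases "0 < t")
      case True
      then show ?thesis
        unfolding conv_def by (intro nn_integral_eq_integral integrable_conv) (auto simp: K.nonneg L.nonneg)
    next
      case False
      then have "k (t - s) * l s = 0" for s
        using K.nonpos[of "t - s"] L.nonpos[of s] by (cases "s \<le> 0") auto
      then show ?thesis by (simp only: conv_def) simp
    qed
    finally show "ennreal (exp (- z * t) * conv t) = (\<integral>\<^sup>+s. ?k (t - s) * ?l s \<partial>lborel)"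
      by (simp add: ennreal_mult conv_nonneg)
  qed
  also have "\<dots> = (\<integral>\<^sup>+s. (\<integral>\<^sup>+t. ?k (t - s) * ?l s \<partial>lborel) \<partial>lborel)"
    by (rule lborel_pair.Fubini'[symmetric]) measurable
  also have "\<dots> = (\<integral>\<^sup>+s. (\<integral>\<^sup>+t. ?k t \<partial>lborel) * ?l s \<partial>lborel)"
  proof (rule nn_integral_cong)
    fix s :: real
    have "(\<integral>\<^sup>+t. ?k t \<partial>lborel) = (\<integral>\<^sup>+t. ?k (t - s) \<partial>lborel)"
      by (subst nn_integral_real_affine[where c = 1 and t = "- s"]) auto
    then show "(\<integral>\<^sup>+t. ?k (t - s) * ?l s \<partial>lborel) = (\<integral>\<^sup>+t. ?k t \<partial>lborel) * ?l s"
      by (simp only:) (rule nn_integral_multc, measurable)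
  qed
  also have "\<dots> = (\<integral>\<^sup>+t. ?k t \<partial>lborel) * (\<integral>\<^sup>+t. ?l t \<partial>lborel)"
    by (rule nn_integral_cmult) measurable
  finally show ?thesis .
qed

text \<open>\<open>conv\<close> and the constant \<open>1\<close> on the half-line share the
  transform \<open>1 / z\<close>. The \<open>n\<close>-th moment of their difference in
  \<open>lerch\<close> compares the transforms at \<open>z = Suc n\<close>.\<close>

lemma conv_eq_1:
  assumes prod: "\<And>z. 0 < z \<Longrightarrow> (\<integral>\<^sup>+t. ennreal (exp (- z * t) * k t) \<partial>lborel)
      * (\<integral>\<^sup>+t. ennreal (exp (- z * t) * l t) \<partial>lborel) = ennreal (1 / z)"
    and "0 < t"
  shows "conv t = 1"
proof -
  have A: "has_bochner_integral lborel (\<lambda>t. exp (- z * t) * conv t) (1 / z)" if "0 < z" for z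
  proof (rule has_bochner_integral_nn_integral)
    show "(\<integral>\<^sup>+t. ennreal (exp (- z * t) * conv t) \<partial>lborel) = ennreal (1 / z)"
      unfolding nn_integral_conv by (rule prod[OF that])
  qed (use that in \<open>auto simp: conv_nonneg\<close>)
  have B: "has_bochner_integral lborel (\<lambda>t. exp (- z * t) * indicator {0<..} t) (1 / z)" if "0 < z" for z :: real
  proof (rule has_bochner_integral_nn_integral)
    show "(\<integral>\<^sup>+t. ennreal (exp (- z * t) * indicator {0<..} t) \<partial>lborel) = ennreal (1 / z)"
      using nn_integral_exp_greaterThan[OF that] by (simp add: ennreal_mult ennreal_indicator)
  qed (use that in auto)
  have D: "has_bochner_integral lborel (\<lambda>t. exp (- t) ^ n * (indicator {0<..} t * (exp (- t) * (conv t - 1)))) 0" for n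
  proof -
    have "exp (- t) ^ n * (indicator {0<..} t * (exp (- t) * (conv t - 1)))
        = exp (- real (Suc n) * t) * conv t - exp (- real (Suc n) * t) * indicator {0<..} t" for t
    proof -
      have "exp (- real (Suc n) * t) = exp (- t) ^ n * exp (- t)"
        by (simp add: exp_of_nat_mult[symmetric] algebra_simps flip: exp_add)
      then show ?thesis
        by (cases "0 < t") (auto simp: conv_nonpos right_diff_distrib)
    qed
    then show ?thesis
      using has_bochner_integral_diff[OF A B, of "real (Suc n)" "real (Suc n)"] by simp
  qed
  have "conv t - 1 = 0"
  proof (rule lerch[OF _ _ _ \<open>0 < t\<close>])
    show "integrable lborel (\<lambda>t. indicator {0<..} t * (exp (- t) * (conv t - 1)))"
      using D[of 0] by (simp add: has_bochner_integral_iff)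
    show "(LINT t|lborel. exp (- t) ^ n * (indicator {0<..} t * (exp (- t) * (conv t - 1)))) = 0" for n
      using D[of n] by (simp add: has_bochner_integral_iff)
    show "continuous_on {0<..} (\<lambda>t. conv t - 1)"
      by (intro continuous_intros conv_continuous)
  qed
  then show ?thesis by simp
qed

lemma half_line_convolution_eq: "half_line_convolution k l t = conv t"
proof -
  have "indicator {0..t} s *\<^sub>R (k (t - s) * l s) = k (t - s) * l s" for s
    using K.nonpos[of "t - s"] L.nonpos[of s] by (cases "0 \<le> s \<and> s \<le> t") (auto simp: indicator_def)
  then have "half_line_convolution k l t = (LINT s|lebesgue. k (t - s) * l s)"
    by (simp only: half_line_convolution_def set_lebesgue_integral_def)
  also have "\<dots> = conv t"
    unfolding conv_def by (rule integral_completion) measurable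
  finally show ?thesis .
qed

lemma kernel_pair_PC:
  assumes "\<And>z. 0 < z \<Longrightarrow> (\<integral>\<^sup>+t. ennreal (exp (- z * t) * k t) \<partial>lborel)
      * (\<integral>\<^sup>+t. ennreal (exp (- z * t) * l t) \<partial>lborel) = ennreal (1 / z)"
  shows "(k, l) \<in> PC"
  unfolding PC_def
  using K.locally_integrable L.locally_integrable K.nonneg K.anti conv_eq_1[OF assms]
  by (auto simp: half_line_convolution_eq)

end

section \<open>Iterates and their asymptotics\<close>

text \<open>In \<open>z = exp u\<close> the last three conditions say that \<open>h\<close> vanishes
  at infinity, that \<open>z * h\<close> vanishes at \<open>0\<close>, and that \<open>Im h\<close>
  is nonpositive on the upper side of the cut.\<close>

lemma stieltjes_kernel_exists:
  assumes ana: "h analytic_on strip"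
    and sym: "\<And>u. u \<in> strip \<Longrightarrow> h (cnj u) = cnj (h u)"
    and top: "(h \<longlongrightarrow> 0) strip_top"
    and bot: "((\<lambda>u. h u * exp u) \<longlongrightarrow> 0) strip_bot"
    and Im: "\<And>y. Im (h (Complex y pi)) \<le> 0"
  shows "\<exists>k. decreasing_kernel k \<and> k \<in> CM \<and>
    (\<forall>z>0. (\<integral>\<^sup>+t. ennreal (exp (- z * t) * k t) \<partial>lborel) = ennreal (Re (h (of_real (ln z)))))"
proof -
  define \<sigma> where "\<sigma> y = - Im (h (Complex y pi)) / pi" for y
  note rep = stieltjes_representation[OF ana sym top bot Im, folded \<sigma>_def]
  have [measurable]: "\<sigma> \<in> borel_measurable borel"
    by (rule borel_measurable_continuous_onI[OF rep(1)])
  have \<sigma>_nonneg: "0 \<le> \<sigma> y" for y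
    using Im[of y] by (simp add: \<sigma>_def divide_nonpos_pos)
  \<comment> \<open>The factor \<open>exp y\<close> is the Jacobian of \<open>s = exp y\<close>, as
    \<open>\<sigma>\<close> is a density with respect to \<open>s\<close>.\<close>
  define M where "M = density lborel (\<lambda>y. ennreal (\<sigma> y * exp y))"
  have density: "(\<integral>\<^sup>+y. ennreal (1 / (exp y + z)) \<partial>M) = ennreal (Re (h (of_real (ln z))))" if "0 < z" for z
  proof -
    have "(\<integral>\<^sup>+y. ennreal (1 / (exp y + z)) \<partial>M)
        = (\<integral>\<^sup>+y. ennreal (\<sigma> y * exp y) * ennreal (1 / (exp y + z)) \<partial>lborel)"
      unfolding M_def by (rule nn_integral_density) measurable
    also have "\<dots> = (\<integral>\<^sup>+y. ennreal (\<sigma> y * (exp y / (exp y + exp (ln z)))) \<partial>lborel)"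
      using that \<sigma>_nonneg by (intro nn_integral_cong) (simp add: add_nonneg_nonneg flip: ennreal_mult)
    also have "\<dots> = ennreal (Re (h (of_real (ln z))))" by (rule rep(2))
    finally show ?thesis .
  qed
  interpret stieltjes_measure M
  proof
    show "sets M = sets borel" by (simp add: M_def)
    show "\<exists>A. countable A \<and> A \<subseteq> sets M \<and> \<Union> A = space M \<and> (\<forall>a\<in>A. emeasure M a \<noteq> \<infinity>)"
    proof -
      have "sigma_finite_measure M"
        unfolding M_def by (subst sigma_finite_measure.sigma_finite_iff_density_finite[OF sigma_finite_lborel]) (auto simp: \<sigma>_nonneg)
      then show ?thesis by (rule sigma_finite_measure.sigma_finite_countable)
    qed
    show "(\<integral>\<^sup>+y. ennreal (1 / (1 + exp y)) \<partial>M) < \<infinity>"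
      using density[of 1] by (simp add: add.commute)
  qed
  have laplace: "(\<integral>\<^sup>+t. ennreal (exp (- z * t) * kernel t) \<partial>lborel) = ennreal (Re (h (of_real (ln z))))" if "0 < z" for z
    using nn_integral_kernel[OF that] density[OF that] by simp
  have "decreasing_kernel kernel"
    using laplace[of 1] kernel_nonpos kernel_nonneg kernel_continuous kernel_antimono
    by unfold_locales auto
  then show ?thesis
    using kernel_CM laplace by blast
qed

text \<open>In terms of the iterates \<open>g\<close> of \<open>G\<close>, this is \<open>1 / g (1 / t)\<close>, for \<open>t > 0\<close>.\<close>

definition real_iter :: "nat \<Rightarrow> real \<Rightarrow> real" where
  "real_iter n t = exp (- Re ((log_mean ^^ n) (of_real (- ln t))))"

lemma of_real_in_strip: "of_real x \<in> strip"
  by (simp add: strip_def)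

lemma log_mean_iter_of_real: "(log_mean ^^ n) (of_real x) = of_real (Re ((log_mean ^^ n) (of_real x)))"
  using log_mean_iter_cnj[OF of_real_in_strip, of n x] by (simp add: complex_eq_iff)

lemma real_iter_0: "0 < t \<Longrightarrow> real_iter 0 t = t"
  by (simp add: real_iter_def)

lemma real_iter_pos: "0 < real_iter n t"
  by (simp add: real_iter_def)

text \<open>The excluded value is the removable singularity of \<open>b * ln b / (b - 1)\<close> at
  \<open>b = 1\<close>: there the iterate stays \<open>1\<close>, whereas division by zero would
  give \<open>0\<close>.\<close>

lemma real_iter_Suc:
  assumes "real_iter n t \<noteq> 1"
  shows "real_iter (Suc n) t = real_iter n t * ln (real_iter n t) / (real_iter n t - 1)"
proof -
  define y where "y = Re ((log_mean ^^ n) (of_real (- ln t)))"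
  have y: "y \<noteq> 0" using assms by (auto simp: real_iter_def y_def)
  have "(log_mean ^^ Suc n) (of_real (- ln t)) = log_mean (of_real y)"
    unfolding y_def funpow.simps o_def by (subst log_mean_iter_of_real) (rule refl)
  moreover have norm_y: "norm (exp_mean (of_real y)) = \<bar>exp y - 1\<bar> / \<bar>y\<bar>"
  proof -
    have "exp (complex_of_real y) - 1 = of_real (exp y - 1)" by (simp add: exp_of_real)
    then have "norm (exp (complex_of_real y) - 1) = \<bar>exp y - 1\<bar>" by (simp only: norm_of_real)
    then show ?thesis using y by (simp add: norm_exp_mean)
  qed
  ultimately have "real_iter (Suc n) t = exp (- ln (\<bar>exp y - 1\<bar> / \<bar>y\<bar>))"
    using norm_y by (simp only: real_iter_def Re_log_mean[OF of_real_in_strip])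
  also have "\<dots> = \<bar>y\<bar> / \<bar>exp y - 1\<bar>"
    using y by (simp add: exp_minus)
  \<comment> \<open>\<open>y\<close> and \<open>exp y - 1\<close> have the same sign.\<close>
  also have "\<dots> = y / (exp y - 1)"
    using y by (cases "0 < y") (auto simp: divide_simps algebra_simps)
  also have "\<dots> = real_iter n t * ln (real_iter n t) / (real_iter n t - 1)"
  proof -
    define w where "w = real_iter n t"
    have w_eq: "w = exp (- y)" by (simp add: w_def real_iter_def y_def)
    have "ln w = - y" unfolding w_eq by (rule ln_exp)
    with w_eq have w: "0 < w" "w \<noteq> 1" "ln w = - y" "exp y = 1 / w"
      using y by (simp_all add: exp_minus divide_inverse)
    then have "1 / w - 1 \<noteq> 0" by (simp add: field_simps)
    then show ?thesis
      unfolding w_def[symmetric] w(3,4) using w(1,2) by (simp add: divide_simps) (simp add: algebra_simps)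
  qed
  finally show ?thesis .
qed

lemma filterlim_real_iter_top: "filterlim (real_iter n) at_top at_top"
  and real_iter_Suc_top: "eventually (\<lambda>t. real_iter (Suc n) t =
        real_iter n t * ln (real_iter n t) / (real_iter n t - 1)) at_top"
proof -
  have step: "eventually (\<lambda>t. real_iter (Suc n) t = real_iter n t * ln (real_iter n t) / (real_iter n t - 1)) at_top"
    if "filterlim (real_iter n) at_top at_top" for n
  proof -
    have "eventually (\<lambda>t. 1 < real_iter n t) at_top"
      using that eventually_gt_at_top[of "1::real"] unfolding filterlim_iff by blast
    then show ?thesis by eventually_elim (rule real_iter_Suc, simp)
  qed
  have lim: "filterlim (real_iter n) at_top at_top" for n
  proof (induction n)
    case 0
    show ?case
    proof (rule filterlim_cong[THEN iffD2, OF refl refl _ filterlim_ident])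
      show "eventually (\<lambda>t. real_iter 0 t = t) at_top"
        using eventually_gt_at_top[of 0] by eventually_elim (rule real_iter_0)
    qed
  next
    case (Suc n)
    have "filterlim (\<lambda>b::real. b * ln b / (b - 1)) at_top at_top" by real_asymp
    from filterlim_compose[OF this Suc] show ?case
      by (subst filterlim_cong[OF refl refl step[OF Suc]])
  qed
  show "filterlim (real_iter n) at_top at_top" by (rule lim)
  show "eventually (\<lambda>t. real_iter (Suc n) t = real_iter n t * ln (real_iter n t) / (real_iter n t - 1)) at_top"
    by (rule step[OF lim])
qed

text \<open>In \<open>ln f = ln g + ln (f / g)\<close> the correction tends to \<open>0\<close>
  while \<open>ln g\<close> tends to infinity.\<close>

lemma asymp_equiv_ln_top:
  fixes f g :: "'a \<Rightarrow> real"
  assumes fg: "f \<sim>[F] g" and g: "filterlim g at_top F"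
  shows "(\<lambda>x. ln (f x)) \<sim>[F] (\<lambda>x. ln (g x))"
proof -
  have f: "filterlim f at_top F"
    using asymp_equiv_at_top_transfer[OF asymp_equiv_symI[OF fg] g] .
  have pos: "eventually (\<lambda>x. 1 < f x \<and> 1 < g x) F"
    using f g eventually_gt_at_top[of "1::real"] unfolding filterlim_iff by (intro eventually_conj) blast+
  have "((\<lambda>x. f x / g x) \<longlongrightarrow> 1) F"
  proof (rule asymp_equivD_strong[OF fg])
    show "eventually (\<lambda>x. f x \<noteq> 0 \<or> g x \<noteq> 0) F" using pos by eventually_elim auto
  qed
  then have "((\<lambda>x. 1 + ln (f x / g x) * inverse (ln (g x))) \<longlongrightarrow> 1 + ln 1 * 0) F"
    by (intro tendsto_intros tendsto_inverse_0_at_top filterlim_compose[OF ln_at_top g]) auto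
  then have "((\<lambda>x. 1 + ln (f x / g x) * inverse (ln (g x))) \<longlongrightarrow> 1) F" by simp
  then show ?thesis
  proof (intro asymp_equivI', elim Lim_transform_eventually)
    show "eventually (\<lambda>x. 1 + ln (f x / g x) * inverse (ln (g x)) = ln (f x) / ln (g x)) F"
      using pos by eventually_elim (auto simp: ln_div field_simps)
  qed
qed

lemma filterlim_ln_iter: "filterlim (ln ^^ n :: real \<Rightarrow> real) at_top at_top"
proof (induction n)
  case (Suc n)
  then show ?case unfolding funpow.simps o_def by (rule filterlim_compose[OF ln_at_top])
qed (simp add: id_def filterlim_ident)

lemma real_iter_asymp_top: "real_iter n \<sim>[at_top] (ln ^^ n)"
proof (induction n)
  case 0
  have "eventually (\<lambda>t. real_iter 0 t = t) at_top"
    using eventually_gt_at_top[of 0] by eventually_elim (rule real_iter_0)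
  then show ?case by (simp add: id_def asymp_equiv_refl_ev)
next
  case (Suc n)
  have "(\<lambda>b::real. b * ln b / (b - 1)) \<sim>[at_top] ln" by real_asymp
  from asymp_equiv_trans[OF asymp_equiv_compose'[OF this filterlim_real_iter_top[of n]]
      asymp_equiv_ln_top[OF Suc filterlim_ln_iter]]
  have "(\<lambda>t. real_iter n t * ln (real_iter n t) / (real_iter n t - 1)) \<sim>[at_top] (ln ^^ Suc n)"
    by (simp add: o_def)
  with asymp_equiv_refl_ev[OF real_iter_Suc_top[of n]] show ?case
    by (rule asymp_equiv_trans)
qed

text \<open>A step multiplies \<open>b\<close> by a factor asymptotic to \<open>- ln b\<close>, and
  \<open>ln b\<close> remains equivalent to \<open>ln t\<close>. So each step adds a factor
  \<open>ln (1 / t)\<close> instead of nesting a logarithm, whence the power \<open>n\<close>. The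
  step for the third claim uses all three, so they are proved together.\<close>

lemma real_iter_right_0:
  shows "filterlim (real_iter n) (at_right 0) (at_right 0)" (is "?L n")
    and "(\<lambda>t. ln (real_iter n t)) \<sim>[at_right 0] ln" (is "?A n")
    and "real_iter n \<sim>[at_right 0] (\<lambda>t. t * ln (inverse t) ^ n)" (is "?B n")
proof -
  have "?L n \<and> ?A n \<and> ?B n"
  proof (induction n)
    case 0
    have ev: "eventually (\<lambda>t. real_iter 0 t = t) (at_right 0)"
      using eventually_at_right_less[of 0] by eventually_elim (rule real_iter_0)
    then have "?L 0" by (subst filterlim_cong[OF refl refl ev]) (rule filterlim_ident)
    moreover have "eventually (\<lambda>t. ln (real_iter 0 t) = ln t) (at_right 0)"
      using ev by eventually_elim simp
    ultimately show ?case using ev by (auto intro: asymp_equiv_refl_ev)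
  next
    case (Suc n)
    then have L: "?L n" and A: "?A n" and B: "?B n" by auto
    let ?F = "\<lambda>b::real. b * ln b / (b - 1)"
    have "eventually (\<lambda>b. b < 1) (at_right (0::real))" by (rule eventually_at_right_field[THEN iffD2]) (auto intro!: exI[of _ 1])
    then have "eventually (\<lambda>t. real_iter n t < 1) (at_right 0)"
      using L unfolding filterlim_iff by blast
    then have ev: "eventually (\<lambda>t. real_iter (Suc n) t = ?F (real_iter n t)) (at_right 0)"
      by eventually_elim (rule real_iter_Suc, simp)
    then have evln: "eventually (\<lambda>t. ln (real_iter (Suc n) t) = ln (?F (real_iter n t))) (at_right 0)"
      by eventually_elim simp
    have "filterlim ?F (at_right 0) (at_right 0)" by real_asymp
    from filterlim_compose[OF this L] have "?L (Suc n)"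
      by (subst filterlim_cong[OF refl refl ev])
    moreover have "(\<lambda>b. ln (?F b)) \<sim>[at_right 0] ln" by real_asymp
    from asymp_equiv_compose'[OF this L] have "(\<lambda>t. ln (?F (real_iter n t))) \<sim>[at_right 0] (\<lambda>t. ln (real_iter n t))" .
    from asymp_equiv_trans[OF asymp_equiv_refl_ev[OF evln] asymp_equiv_trans[OF this A]]
    have "?A (Suc n)" .
    moreover have "?B (Suc n)"
    proof -
      have "?F \<sim>[at_right 0] (\<lambda>b. b * - ln b)" by real_asymp
      note asymp_equiv_compose'[OF this L]
      moreover have "(\<lambda>t. real_iter n t * - ln (real_iter n t)) \<sim>[at_right 0] (\<lambda>t. (t * ln (inverse t) ^ n) * - ln t)"
        by (intro asymp_equiv_mult B asymp_equiv_uminus A)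
      moreover have "(\<lambda>t::real. (t * ln (inverse t) ^ n) * - ln t) \<sim>[at_right 0] (\<lambda>t. t * ln (inverse t) ^ Suc n)"
      proof (rule asymp_equiv_refl_ev)
        show "eventually (\<lambda>t. (t * ln (inverse t) ^ n) * - ln t = t * ln (inverse t) ^ Suc n) (at_right (0::real))"
          using eventually_at_right_less[of 0] by eventually_elim (simp add: ln_inverse)
      qed
      ultimately have "(\<lambda>t. ?F (real_iter n t)) \<sim>[at_right 0] (\<lambda>t. t * ln (inverse t) ^ Suc n)"
        by (blast intro: asymp_equiv_trans)
      with asymp_equiv_refl_ev[OF ev] show ?thesis by (rule asymp_equiv_trans)
    qed
    ultimately show ?case by blast
  qed
  then show "?L n" "?A n" "?B n" by auto
qed

theorem corollary3p16:
  fixes n :: nat and \<delta> :: real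
  assumes "n \<ge> 1" and "0 < \<delta>" and "\<delta> < 1"
  shows "\<exists>\<phi> \<psi>. (\<phi>, \<psi>) \<in> PC \<and> \<phi> \<in> CM \<and>
    (\<lambda>t::real. laplace_transform \<psi> (inverse t)) \<sim>[at_top] (\<lambda>t. ((ln ^^ n) t) powr \<delta>) \<and>
    (\<lambda>t::real. laplace_transform \<psi> (inverse t)) \<sim>[at_right 0]
      (\<lambda>t. t powr \<delta> * ln (inverse t) powr (\<delta> * real n))"
proof -
  define A where "A = log_mean ^^ n"
  \<comment> \<open>\<open>g powr \<delta> / z\<close> and \<open>g powr - \<delta>\<close> in the coordinate \<open>u = ln z\<close>\<close>
  define hk where "hk u = exp (of_real \<delta> * A u - u)" for u
  define hl where "hl u = exp (- of_real \<delta> * A u)" for u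
  have ana: "A analytic_on strip" unfolding A_def by (rule log_mean_iter_analytic)
  have A_strip: "A u \<in> strip" and A_cnj: "A (cnj u) = cnj (A u)" if "u \<in> strip" for u
    using that by (simp_all add: A_def log_mean_iter_in_strip log_mean_iter_cnj)
  have Im_A: "0 \<le> Im (A (Complex y pi)) \<and> Im (A (Complex y pi)) \<le> pi" for y
    using A_strip[of "Complex y pi"] Im_log_mean_iter_nonneg[of "Complex y pi" n]
    by (simp add: A_def strip_def)
  have sin: "0 \<le> sin (\<delta> * Im (A (Complex y pi)))" for y
    using Im_A[of y] assms mult_mono[of \<delta> 1 "Im (A (Complex y pi))" pi] by (intro sin_ge_zero) auto
  have Re_top: "filterlim (\<lambda>u. Re (A u)) at_top strip_top"
    unfolding A_def by (rule filterlim_compose[OF filterlim_Re_strip_top filterlim_log_mean_iter_top])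
  have Re_bot: "filterlim (\<lambda>u. Re (A u)) at_bot strip_bot"
    unfolding A_def by (rule filterlim_compose[OF filterlim_Re_strip_bot filterlim_log_mean_iter_bot])
  have exp_top: "((\<lambda>u. exp (- c * Re (B u))) \<longlongrightarrow> 0) F" if "0 < c" "filterlim (\<lambda>u. Re (B u)) at_top F"
    for c :: real and B :: "complex \<Rightarrow> complex" and F
  proof (rule filterlim_compose[OF exp_at_bot])
    show "filterlim (\<lambda>u. - c * Re (B u)) at_bot F"
      by (rule filterlim_tendsto_neg_mult_at_bot[OF tendsto_const _ that(2)]) (use that(1) in simp)
  qed
  have exp_bot: "((\<lambda>u. exp (c * Re (B u))) \<longlongrightarrow> 0) F" if "0 < c" "filterlim (\<lambda>u. Re (B u)) at_bot F"
    for c :: real and B :: "complex \<Rightarrow> complex" and F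
  proof (rule filterlim_compose[OF exp_at_bot])
    show "filterlim (\<lambda>u. c * Re (B u)) at_bot F"
      by (rule filterlim_tendsto_pos_mult_at_bot[OF tendsto_const that])
  qed
  have "\<exists>k. decreasing_kernel k \<and> k \<in> CM \<and>
    (\<forall>z>0. (\<integral>\<^sup>+t. ennreal (exp (- z * t) * k t) \<partial>lborel) = ennreal (Re (hk (of_real (ln z)))))"
  proof (rule stieltjes_kernel_exists)
    show "hk analytic_on strip" unfolding hk_def by (intro analytic_intros ana)
    show "hk (cnj u) = cnj (hk u)" if "u \<in> strip" for u
      using that by (simp add: hk_def A_cnj exp_cnj)
    \<comment> \<open>The comparison \<open>|g| \<le> |z|\<close> near infinity leaves
      \<open>|z| powr (\<delta> - 1)\<close>. Its counterpart \<open>|g| \<ge> |z|\<close> near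
      \<open>0\<close> serves \<open>hl\<close> at \<open>strip_bot\<close> in the same way.\<close>
    show "(hk \<longlongrightarrow> 0) strip_top"
    proof (rule Lim_null_comparison)
      show "((\<lambda>u. exp (- (1 - \<delta>) * Re u)) \<longlongrightarrow> 0) strip_top"
        using exp_top[of "1 - \<delta>" "\<lambda>u. u" strip_top] assms filterlim_Re_strip_top by simp
      show "eventually (\<lambda>u. norm (hk u) \<le> exp (- (1 - \<delta>) * Re u)) strip_top"
        using eventually_Re_log_mean_iter_le[of n]
      proof eventually_elim
        case (elim u)
        then have "\<delta> * Re (A u) \<le> \<delta> * Re u" using assms by (simp add: A_def)
        then show ?case by (simp add: hk_def algebra_simps)
      qed
    qed
    show "((\<lambda>u. hk u * exp u) \<longlongrightarrow> 0) strip_bot"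
    proof (rule tendsto_norm_zero_cancel)
      show "((\<lambda>u. norm (hk u * exp u)) \<longlongrightarrow> 0) strip_bot"
        using exp_bot[OF \<open>0 < \<delta>\<close> Re_bot] by (simp add: hk_def flip: exp_add)
    qed
    \<comment> \<open>Division by \<open>z\<close> contributes the phase \<open>- pi\<close> on the
      upper edge and so reverses the sign of the sine; for \<open>hl\<close> the negative exponent
      does this.\<close>
    show "Im (hk (Complex y pi)) \<le> 0" for y
      using sin[of y] by (simp add: hk_def Im_exp)
  qed
  then obtain k where k: "decreasing_kernel k" "k \<in> CM"
    "\<And>z. 0 < z \<Longrightarrow> (\<integral>\<^sup>+t. ennreal (exp (- z * t) * k t) \<partial>lborel) = ennreal (Re (hk (of_real (ln z))))"
    by blast
  have "\<exists>k. decreasing_kernel k \<and> k \<in> CM \<and>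
    (\<forall>z>0. (\<integral>\<^sup>+t. ennreal (exp (- z * t) * k t) \<partial>lborel) = ennreal (Re (hl (of_real (ln z)))))"
  proof (rule stieltjes_kernel_exists)
    show "hl analytic_on strip" unfolding hl_def by (intro analytic_intros ana)
    show "hl (cnj u) = cnj (hl u)" if "u \<in> strip" for u
      using that by (simp add: hl_def A_cnj exp_cnj)
    show "(hl \<longlongrightarrow> 0) strip_top"
    proof (rule tendsto_norm_zero_cancel)
      show "((\<lambda>u. norm (hl u)) \<longlongrightarrow> 0) strip_top"
        using exp_top[OF \<open>0 < \<delta>\<close> Re_top] by (simp add: hl_def)
    qed
    show "((\<lambda>u. hl u * exp u) \<longlongrightarrow> 0) strip_bot"
    proof (rule Lim_null_comparison)
      show "((\<lambda>u. exp ((1 - \<delta>) * Re u)) \<longlongrightarrow> 0) strip_bot"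
        using exp_bot[of "1 - \<delta>" "\<lambda>u. u" strip_bot] assms filterlim_Re_strip_bot by simp
      show "eventually (\<lambda>u. norm (hl u * exp u) \<le> exp ((1 - \<delta>) * Re u)) strip_bot"
        using eventually_Re_log_mean_iter_ge[of n]
      proof eventually_elim
        case (elim u)
        then have "\<delta> * Re u \<le> \<delta> * Re (A u)" using assms by (simp add: A_def)
        then show ?case by (simp add: hl_def norm_mult algebra_simps flip: exp_add)
      qed
    qed
    show "Im (hl (Complex y pi)) \<le> 0" for y
      using sin[of y] by (simp add: hl_def Im_exp)
  qed
  then obtain l where l: "decreasing_kernel l"
    "\<And>z. 0 < z \<Longrightarrow> (\<integral>\<^sup>+t. ennreal (exp (- z * t) * l t) \<partial>lborel) = ennreal (Re (hl (of_real (ln z))))"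
    by blast
  \<comment> \<open>At real points \<open>g z = 1 / real_iter n (inverse z)\<close>, which turns the
    exponent \<open>- \<delta>\<close> into \<open>\<delta>\<close>.\<close>
  have hl_real: "Re (hl (of_real (ln z))) = real_iter n (inverse z) powr \<delta>" if "0 < z" for z
  proof -
    have "A (of_real (ln z)) = of_real (- ln (real_iter n (inverse z)))"
      using log_mean_iter_of_real[of n "ln z"] that by (simp add: A_def real_iter_def ln_inverse)
    then show ?thesis
      using real_iter_pos[of n "inverse z"] by (simp add: hl_def powr_def Re_exp)
  qed
  have hk_real: "Re (hk (of_real (ln z))) = inverse (real_iter n (inverse z) powr \<delta>) / z" if "0 < z" for z
  proof -
    have "A (of_real (ln z)) = of_real (- ln (real_iter n (inverse z)))"
      using log_mean_iter_of_real[of n "ln z"] that by (simp add: A_def real_iter_def ln_inverse)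
    then have "hk (of_real (ln z)) = of_real (exp (\<delta> * - ln (real_iter n (inverse z)) - ln z))"
      by (simp only: hk_def of_real_mult [symmetric] of_real_diff [symmetric] exp_of_real)
    then have "Re (hk (of_real (ln z))) = exp (\<delta> * - ln (real_iter n (inverse z)) - ln z)"
      by (simp only: Re_complex_of_real)
    then show ?thesis
      using real_iter_pos[of n "inverse z"] that by (simp add: powr_def exp_diff exp_minus)
  qed
  interpret kernel_pair k l
    by (intro kernel_pair.intro k l)
  have PC: "(k, l) \<in> PC"
  proof (rule kernel_pair_PC)
    fix z :: real assume z: "0 < z"
    have "inverse (real_iter n (inverse z) powr \<delta>) / z * real_iter n (inverse z) powr \<delta> = 1 / z"
      using real_iter_pos[of n "inverse z"] by simp
    then show "(\<integral>\<^sup>+t. ennreal (exp (- z * t) * k t) \<partial>lborel) * (\<integral>\<^sup>+t. ennreal (exp (- z * t) * l t) \<partial>lborel)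
        = ennreal (1 / z)"
      unfolding k(3)[OF z] l(2)[OF z] hk_real[OF z] hl_real[OF z]
      using z by (subst ennreal_mult [symmetric]) auto
  qed
  have lap: "laplace_transform l (inverse t) = real_iter n t powr \<delta>" if "0 < t" for t
    by (rule L.laplace_transform_eq) (use that l(2)[of "inverse t"] hl_real[of "inverse t"] in auto)
  have "(\<lambda>t. laplace_transform l (inverse t)) \<sim>[at_top] (\<lambda>t. real_iter n t powr \<delta>)"
    by (rule asymp_equiv_refl_ev, use eventually_gt_at_top[of 0] in eventually_elim) (rule lap)
  moreover have "(\<lambda>t. real_iter n t powr \<delta>) \<sim>[at_top] (\<lambda>t. ((ln ^^ n) t) powr \<delta>)"
  proof (rule asymp_equiv_powr_real[OF real_iter_asymp_top])
    show "eventually (\<lambda>t. 0 \<le> real_iter n t) at_top"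
      using less_imp_le[OF real_iter_pos] by simp
    show "eventually (\<lambda>t::real. 0 \<le> (ln ^^ n) t) at_top"
      using filterlim_ln_iter[of n] eventually_ge_at_top[of "0::real"] unfolding filterlim_iff by blast
  qed
  ultimately have asymp_top: "(\<lambda>t. laplace_transform l (inverse t)) \<sim>[at_top] (\<lambda>t. ((ln ^^ n) t) powr \<delta>)"
    by (rule asymp_equiv_trans)
  \<comment> \<open>For \<open>0 < t < 1\<close> the base \<open>ln (inverse t)\<close> is positive,
    as needed to split the real powers.\<close>
  have small: "eventually (\<lambda>t. 0 < t \<and> t < 1) (at_right (0::real))"
    by (rule eventually_at_right_field[THEN iffD2]) (auto intro!: exI[of _ 1])
  have "(\<lambda>t. laplace_transform l (inverse t)) \<sim>[at_right 0] (\<lambda>t. real_iter n t powr \<delta>)"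
    by (rule asymp_equiv_refl_ev, use eventually_at_right_less[of 0] in eventually_elim) (rule lap)
  moreover have "(\<lambda>t. real_iter n t powr \<delta>) \<sim>[at_right 0] (\<lambda>t. (t * ln (inverse t) ^ n) powr \<delta>)"
  proof (rule asymp_equiv_powr_real[OF real_iter_right_0(3)])
    show "eventually (\<lambda>t. 0 \<le> real_iter n t) (at_right 0)"
      using less_imp_le[OF real_iter_pos] by simp
    show "eventually (\<lambda>t. 0 \<le> t * ln (inverse t) ^ n) (at_right (0::real))"
      using small by eventually_elim (auto intro!: mult_nonneg_nonneg zero_le_power simp: ln_inverse)
  qed
  moreover have "(\<lambda>t. (t * ln (inverse t) ^ n) powr \<delta>) \<sim>[at_right 0] (\<lambda>t. t powr \<delta> * ln (inverse t) powr (\<delta> * real n))"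
  proof (rule asymp_equiv_refl_ev)
    show "eventually (\<lambda>t. (t * ln (inverse t) ^ n) powr \<delta> = t powr \<delta> * ln (inverse t) powr (\<delta> * real n)) (at_right 0)"
      using small
    proof eventually_elim
      case (elim t)
      then have "0 < ln (inverse t)" by (simp add: ln_inverse)
      then show ?case
        using elim by (simp add: powr_mult powr_powr mult.commute flip: powr_realpow)
    qed
  qed
  ultimately have "(\<lambda>t. laplace_transform l (inverse t)) \<sim>[at_right 0] (\<lambda>t. t powr \<delta> * ln (inverse t) powr (\<delta> * real n))"
    by (blast intro: asymp_equiv_trans)
  with PC k(2) asymp_top show ?thesis by blast
qed

end
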